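(* Let $D$ be an integral domain and let $\Theta$ be a weak Jaffard family of $D$ pointed at $T_\infty$. Then there is an exact sequence $$0\longrightarrow\bigoplus_{T\in\Theta\setminus\{T_\infty\}}\mathrm{Pic}_{\mathrm{Int}}(T)\longrightarrow\mathrm{Pic}_{\mathrm{Int}}(D)\longrightarrow\mathrm{Pic}_{\mathrm{Int}}(D,T_\infty)\longrightarrow 0.$$
   Context: $D$ is an integral domain with quotient field $K$; for a domain $A$ with quotient field $K$, $\mathrm{Int}(A)=\{f\in K[X]\mid f(A)\subseteq A\}$ and $\mathrm{Pic}(A)$ is the group of invertible fractional ideals modulo principal ones. $\mathrm{Pic}_{\mathrm{Int}}(A):=\mathrm{Pic}(\mathrm{Int}(A))/\iota_A(\mathrm{Pic}(A))$ where $\iota_A([I])=[I\,\mathrm{Int}(A)]$. For a flat overring $T$ of $D$, $\mathrm{Int}(D)T$ is the subring of $K[X]$ of finite sums $\sum f_it_i$ ($f_i\in\mathrm{Int}(D)$, $t_i\in T$), and $\mathrm{Pic}_{\mathrm{Int}}(D,T):=\mathrm{Pic}(\mathrm{Int}(D)T)/\iota_{D,T}(\mathrm{Pic}(T))$ with $\iota_{D,T}([I])=[I\,\mathrm{Int}(D)T]$. An overring is a ring between $D$ and $K$, flat if flat as a $D$-module. A family $\Theta$ of overrings of a domain $R$ (with quotient field $K$) is a pre-Jaffard family of $R$ if: $\Theta=\{K\}$ or $K\notin\Theta$; every member is flat over $R$; $\Theta$ is complete (every ideal $I$ of $R$ equals $\bigcap_{T\in\Theta}IT$); independent ($TT'=K$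 for distinct $T,T'\in\Theta$); and compact in the Zariski topology on overrings (subbasic opens $\{T\mid x_1,\dots,x_n\in T\}$). A Jaffard family is a pre-Jaffard family that is locally finite (each nonzero $x\in R$ is a nonunit in only finitely many members); a Jaffard overring of $R$ is a member of some Jaffard family of $R$. For a pre-Jaffard family $\Theta$ of $D$, let $T_0:=\bigcap\Theta=D$ and let $\mathcal{N}^1(\Theta)$ be the set of $T\in\Theta$ that are not Jaffard overrings of $D$. $\Theta$ is a weak Jaffard family pointed at $T_\infty$ if $\mathcal{N}^1(\Theta)=\{T_\infty\}$. *)

theory Defs
  imports "HOL-Analysis.Analysis" "HOL-Algebra.Product_Groups"
          "HOL-Computational_Algebra.Polynomial" "HOL-Computational_Algebra.Fraction_Field"
begin

definition subring_of :: "'a::field set \<Rightarrow> bool" where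
  "subring_of R \<longleftrightarrow> 0 \<in> R \<and> 1 \<in> R \<and> (\<forall>x\<in>R. \<forall>y\<in>R. x + y \<in> R \<and> x - y \<in> R \<and> x * y \<in> R)"

definition domain_with_qf :: "'a::field set \<Rightarrow> bool" where
  "domain_with_qf D \<longleftrightarrow> subring_of D \<and> (\<forall>k. \<exists>a\<in>D. \<exists>b\<in>D. b \<noteq> 0 \<and> k = a / b)"

definition overring :: "'a::field set \<Rightarrow> 'a set \<Rightarrow> bool" where
  "overring D T \<longleftrightarrow> subring_of T \<and> D \<subseteq> T"

text \<open>Flatness of T as a D-module, via the equational criterion for flatness.\<close>
definition flat_over :: "'a::field set \<Rightarrow> 'a set \<Rightarrow> bool" where
  "flat_over D T \<longleftrightarrow>
     (\<forall>(n::nat) r m. (\<forall>i<n. r i \<in> D \<and> m i \<in> T) \<and> (\<Sum>i<n. r i * m i) = 0 \<longrightarrow>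
        (\<exists>(p::nat) a m'. (\<forall>i<n. \<forall>j<p. a i j \<in> D) \<and> (\<forall>j<p. m' j \<in> T) \<and>
            (\<forall>i<n. m i = (\<Sum>j<p. a i j * m' j)) \<and>
            (\<forall>j<p. (\<Sum>i<n. r i * a i j) = 0)))"

definition flat_overring :: "'a::field set \<Rightarrow> 'a set \<Rightarrow> bool" where
  "flat_overring D T \<longleftrightarrow> overring D T \<and> flat_over D T"

text \<open>Set of finite sums of products (product of submodules / ring generated by two subrings).\<close>
definition set_prod :: "'a::comm_ring_1 set \<Rightarrow> 'a set \<Rightarrow> 'a set" where
  "set_prod I J = {x. \<exists>(n::nat) a b. (\<forall>i<n. a i \<in> I \<and> b i \<in> J) \<and> x = (\<Sum>i<n. a i * b i)}"

definition ext_ideal :: "'b::comm_ring_1 set \<Rightarrow> ('a \<Rightarrow> 'b) \<Rightarrow> 'a set \<Rightarrow> 'b set" where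
  "ext_ideal S \<sigma> I = {x. \<exists>(n::nat) s y. (\<forall>i<n. s i \<in> S \<and> y i \<in> I) \<and> x = (\<Sum>i<n. s i * \<sigma> (y i))}"

definition ideal_of :: "'a::comm_ring_1 set \<Rightarrow> 'a set \<Rightarrow> bool" where
  "ideal_of R I \<longleftrightarrow> I \<subseteq> R \<and> 0 \<in> I \<and> (\<forall>x\<in>I. \<forall>y\<in>I. x + y \<in> I) \<and> (\<forall>r\<in>R. \<forall>x\<in>I. r * x \<in> I)"

definition submodule_of :: "'a::field set \<Rightarrow> 'a set \<Rightarrow> bool" where
  "submodule_of R I \<longleftrightarrow> 0 \<in> I \<and> (\<forall>x\<in>I. \<forall>y\<in>I. x + y \<in> I) \<and> (\<forall>r\<in>R. \<forall>x\<in>I. r * x \<in> I)"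

text \<open>Fractional ideals of a subring R of a field L, where L is the quotient field of R.\<close>
definition frac_ideal :: "'a::field set \<Rightarrow> 'a set \<Rightarrow> bool" where
  "frac_ideal R I \<longleftrightarrow> submodule_of R I \<and> I \<noteq> {0} \<and> (\<exists>d\<in>R. d \<noteq> 0 \<and> (\<forall>x\<in>I. d * x \<in> R))"

definition inv_frac_ideal :: "'a::field set \<Rightarrow> 'a set \<Rightarrow> bool" where
  "inv_frac_ideal R I \<longleftrightarrow> frac_ideal R I \<and> (\<exists>J. frac_ideal R J \<and> set_prod I J = R)"

definition principal_frac :: "'a::field set \<Rightarrow> 'a set set" where
  "principal_frac R = {I. \<exists>x. x \<noteq> 0 \<and> I = (\<lambda>r. x * r) ` R}"

definition Inv_group :: "'a::field set \<Rightarrow> 'a set monoid" where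
  "Inv_group R = \<lparr>carrier = {I. inv_frac_ideal R I}, mult = set_prod, one = R\<rparr>"

definition Pic :: "'a::field set \<Rightarrow> 'a set set monoid" where
  "Pic R = Inv_group R Mod principal_frac R"

definition pic_class :: "'a::field set \<Rightarrow> 'a set \<Rightarrow> 'a set set" where
  "pic_class S J = principal_frac S #>\<^bsub>Inv_group S\<^esub> J"

text \<open>The image of \<iota>: Pic(R) \<rightarrow> Pic(S), [I] \<mapsto> [I S], where \<sigma> embeds the quotient field of R into that of S.\<close>
definition iota_image :: "'a::field set \<Rightarrow> 'b::field set \<Rightarrow> ('a \<Rightarrow> 'b) \<Rightarrow> 'b set set set" where
  "iota_image R S \<sigma> = {pic_class S (ext_ideal S \<sigma> I) | I. inv_frac_ideal R I}"

definition Pic_quot :: "'a::field set \<Rightarrow> 'b::field set \<Rightarrow> ('a \<Rightarrow> 'b) \<Rightarrow> 'b set set set monoid" where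
  "Pic_quot R S \<sigma> = Pic S Mod iota_image R S \<sigma>"

definition Int_poly :: "'a::field set \<Rightarrow> 'a poly set" where
  "Int_poly A = {f. \<forall>a\<in>A. poly f a \<in> A}"

definition Int_poly_ext :: "'a::field set \<Rightarrow> 'a set \<Rightarrow> 'a poly set" where
  "Int_poly_ext D T = {g. \<exists>(n::nat) f t. (\<forall>i<n. f i \<in> Int_poly D \<and> t i \<in> T) \<and> g = (\<Sum>i<n. f i * [:t i:])}"

definition poly_fract :: "'a::field poly \<Rightarrow> 'a poly fract" where
  "poly_fract p = Fract p 1"

definition const_fract :: "'a::field \<Rightarrow> 'a poly fract" where
  "const_fract c = poly_fract [:c:]"

definition PicInt :: "'a::field set \<Rightarrow> 'a poly fract set set set monoid" where
  "PicInt A = Pic_quot A (poly_fract ` Int_poly A) const_fract"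

definition PicInt2 :: "'a::field set \<Rightarrow> 'a set \<Rightarrow> 'a poly fract set set set monoid" where
  "PicInt2 D T = Pic_quot T (poly_fract ` Int_poly_ext D T) const_fract"

definition zariski :: "'a::field set \<Rightarrow> 'a set topology" where
  "zariski D = topology_generated_by {{T. overring D T \<and> F \<subseteq> T} | F. finite F}"

definition pre_jaffard :: "'a::field set \<Rightarrow> 'a set set \<Rightarrow> bool" where
  "pre_jaffard D \<Theta> \<longleftrightarrow>
     (\<Theta> = {UNIV} \<or> UNIV \<notin> \<Theta>) \<and>
     (\<forall>T\<in>\<Theta>. flat_overring D T) \<and>
     (\<forall>I. ideal_of D I \<longrightarrow> I = (\<Inter>T\<in>\<Theta>. ext_ideal T id I)) \<and>
     (\<forall>T\<in>\<Theta>. \<forall>T'\<in>\<Theta>. T \<noteq> T' \<longrightarrow> set_prod T T' = UNIV) \<and>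
     compactin (zariski D) \<Theta>"

definition jaffard_family :: "'a::field set \<Rightarrow> 'a set set \<Rightarrow> bool" where
  "jaffard_family D \<Theta> \<longleftrightarrow> pre_jaffard D \<Theta> \<and>
     (\<forall>x\<in>D. x \<noteq> 0 \<longrightarrow> finite {T\<in>\<Theta>. inverse x \<notin> T})"

definition jaffard_overring :: "'a::field set \<Rightarrow> 'a set \<Rightarrow> bool" where
  "jaffard_overring D T \<longleftrightarrow> (\<exists>\<Theta>. jaffard_family D \<Theta> \<and> T \<in> \<Theta>)"

definition N1 :: "'a::field set \<Rightarrow> 'a set set \<Rightarrow> 'a set set" where
  "N1 D \<Theta> = {T\<in>\<Theta>. \<not> jaffard_overring D T}"

definition weak_jaffard_pointed :: "'a::field set \<Rightarrow> 'a set set \<Rightarrow> 'a set \<Rightarrow> bool" where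
  "weak_jaffard_pointed D \<Theta> Tinf \<longleftrightarrow> pre_jaffard D \<Theta> \<and> N1 D \<Theta> = {Tinf}"

end

theory Submission
  imports Defs
begin

text \<open>The rings \<open>Int(D) T\<close>, \<open>T \<in> \<Theta>\<close>, are localizations of \<open>Int(D)\<close>, and \<open>D\<close>-submodules of \<open>K(X)\<close> are
  determined by their localizations because \<open>\<Theta>\<close> is complete. The key finiteness statement is that an
  element of \<open>Int(D) T\<^sub>\<infinity>\<close> lies in \<open>Int(D) T\<close> for all but finitely many \<open>T \<in> \<Theta>\<close>. Since the other members
  of \<open>\<Theta>\<close> are Jaffard overrings, local data that agree with one global module outside finitely many of
  them can be glued by intersection. Scaling an invertible ideal \<open>I\<close> of \<open>Int(D)\<close> one may assume that it is
  unitary, \<open>I K = K[X]\<close>. The unitary ideals \<open>I\<close> with \<open>I T\<^sub>\<infinity> = Int(D) T\<^sub>\<infinity>\<close> map onto the direct sum by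
  \<open>I \<mapsto> ([I T])\<close> and into \<open>PicInt(D)\<close> by \<open>I \<mapsto> [I]\<close>; the two maps have the same fibres, which yields the
  first arrow. The second arrow is \<open>[I] \<mapsto> [I T\<^sub>\<infinity>]\<close>; it is surjective because every invertible ideal
  over \<open>T\<^sub>\<infinity>\<close> lifts by gluing it with trivial ideals at the finitely many exceptional members.\<close>

text \<open>The obstacle to a direct definition of the first arrow is that a class over Int(T)
  determines an ideal only up to a factor from K(X) and an ideal of T, while the gluing needs local
  modules with one common generic fibre that come from one global module outside a finite set.
  Unitary ideals repair this: K[X] is a principal ideal domain, so every class has a representative
  with generic fibre K[X], and two such representatives of one class differ by a unit of K[X], a
  constant, which can be absorbed into the invertible ideal of T. These correction ideals must in
  turn be glued to an ideal of \<open>D\<close>; this is why the gluing is carried out for a field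
  embedding \<sigma>, once with the constants K -> K(X) and once with the identity of K. The Jaffard
  property enters as a way to confine a denominator to a single member of \<Theta>.\<close>

notation set_prod (infixl "\<star>" 70)

subsection \<open>Products of additive subgroups\<close>

lemma set_prod_zero: "0 \<in> I \<star> J"
  unfolding set_prod_def by (auto intro!: exI[of _ "0::nat"])

lemma set_prod_mult: "a \<in> I \<Longrightarrow> b \<in> J \<Longrightarrow> a * b \<in> I \<star> J"
  unfolding set_prod_def by (intro CollectI exI[of _ "Suc 0"] exI[of _ "\<lambda>_. a"] exI[of _ "\<lambda>_. b"]) auto

lemma set_prod_add:
  assumes "x \<in> I \<star> J" "y \<in> I \<star> J"
  shows "x + y \<in> I \<star> J"
proof -
  obtain n a b where 1: "\<forall>i<n. a i \<in> I \<and> b i \<in> J" "x = (\<Sum>i<(n::nat). a i * b i)"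
    using assms(1) unfolding set_prod_def by auto
  obtain m c d where 2: "\<forall>i<m. c i \<in> I \<and> d i \<in> J" "y = (\<Sum>i<(m::nat). c i * d i)"
    using assms(2) unfolding set_prod_def by auto
  let ?a = "\<lambda>i. if i < n then a i else c (i - n)"
  let ?b = "\<lambda>i. if i < n then b i else d (i - n)"
  have "(\<Sum>i<n+k. ?a i * ?b i) = (\<Sum>i<n. a i * b i) + (\<Sum>i<k. c i * d i)" for k
    by (induction k) (simp_all add: add.assoc)
  then have "x + y = (\<Sum>i<n+m. ?a i * ?b i)"
    by (simp add: 1(2) 2(2))
  moreover have "\<forall>i<n+m. ?a i \<in> I \<and> ?b i \<in> J"
    using 1(1) 2(1) by auto
  ultimately show ?thesis
    unfolding set_prod_def by (intro CollectI exI[of _ "n + m"] exI[of _ ?a] exI[of _ ?b] conjI)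
qed

lemma set_prod_induct [consumes 1, case_names zero add mult]:
  assumes "x \<in> I \<star> J"
    and "P 0" and "\<And>x y. P x \<Longrightarrow> P y \<Longrightarrow> P (x + y)"
    and "\<And>a b. a \<in> I \<Longrightarrow> b \<in> J \<Longrightarrow> P (a * b)"
  shows "P x"
proof -
  obtain n a b where x: "\<forall>i<n. a i \<in> I \<and> b i \<in> J" "x = (\<Sum>i<(n::nat). a i * b i)"
    using assms(1) unfolding set_prod_def by auto
  have "m \<le> n \<Longrightarrow> P (\<Sum>i<m. a i * b i)" for m
    by (induction m) (use assms(2-4) x(1) in auto)
  then show ?thesis
    using x(2) by blast
qed

lemma set_prod_subset:
  assumes "0 \<in> M" "\<And>x y. x \<in> M \<Longrightarrow> y \<in> M \<Longrightarrow> x + y \<in> M"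
    and "\<And>a b. a \<in> I \<Longrightarrow> b \<in> J \<Longrightarrow> a * b \<in> M"
  shows "I \<star> J \<subseteq> M"
proof
  fix x assume "x \<in> I \<star> J"
  then show "x \<in> M"
    by (induction rule: set_prod_induct) (use assms in auto)
qed

lemma set_prod_mono: "I \<subseteq> I' \<Longrightarrow> J \<subseteq> J' \<Longrightarrow> I \<star> J \<subseteq> I' \<star> J'"
  by (rule set_prod_subset) (auto intro: set_prod_zero set_prod_add set_prod_mult)

lemma set_prod_commute: "I \<star> J = J \<star> (I :: 'a::comm_ring_1 set)"
proof -
  have "a * b \<in> J \<star> I" if "a \<in> I" "b \<in> J" for a b and I J :: "'a set"
    using set_prod_mult[OF that(2,1)] by (simp add: mult.commute)
  then have "I \<star> J \<subseteq> J \<star> I" for I J :: "'a set"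
    by (intro set_prod_subset set_prod_zero set_prod_add)
  then show ?thesis by blast
qed

lemma set_prod_assoc: "(I \<star> J) \<star> N = I \<star> (J \<star> N)"
proof -
  have 1: "(I \<star> J) \<star> N \<subseteq> I \<star> (J \<star> N)" for I J N :: "'a::comm_ring_1 set"
  proof (rule set_prod_subset)
    fix a b assume a: "a \<in> I \<star> J" and b: "b \<in> N"
    from a show "a * b \<in> I \<star> (J \<star> N)"
    proof (induction rule: set_prod_induct)
      case (mult x y)
      then have "x * (y * b) \<in> I \<star> (J \<star> N)"
        using b by (intro set_prod_mult)
      then show ?case by (simp add: mult.assoc)
    qed (auto intro: set_prod_zero set_prod_add simp: distrib_right)
  qed (auto intro: set_prod_zero set_prod_add)
  have "I \<star> (J \<star> N) = (N \<star> J) \<star> I"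
    by (simp add: set_prod_commute)
  also have "\<dots> \<subseteq> N \<star> (J \<star> I)"
    by (rule 1)
  also have "\<dots> = (I \<star> J) \<star> N"
    by (simp add: set_prod_commute)
  finally show ?thesis using 1 by blast
qed

lemma set_prod_left_commute: "I \<star> (J \<star> N) = J \<star> (I \<star> N)"
  by (metis set_prod_assoc set_prod_commute)

lemmas set_prod_ac = set_prod_assoc set_prod_commute set_prod_left_commute

text \<open>Brings extended ideals into the product calculus, where the laws
  \<open>set_prod_ac\<close> replace manipulations of indexed sums.\<close>

lemma ext_ideal_eq: "ext_ideal S \<sigma> I = S \<star> (\<sigma> ` I)"
proof (intro equalityI subsetI)
  fix x assume "x \<in> ext_ideal S \<sigma> I"
  then obtain n s y where "\<forall>i<n. s i \<in> S \<and> y i \<in> I" "x = (\<Sum>i<(n::nat). s i * \<sigma> (y i))"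
    unfolding ext_ideal_def by blast
  then show "x \<in> S \<star> (\<sigma> ` I)"
    unfolding set_prod_def by (intro CollectI exI[of _ n] exI[of _ s] exI[of _ "\<lambda>i. \<sigma> (y i)"]) auto
next
  fix x assume "x \<in> S \<star> (\<sigma> ` I)"
  then obtain n s b where s: "\<forall>i<n. s i \<in> S \<and> b i \<in> \<sigma> ` I" "x = (\<Sum>i<(n::nat). s i * b i)"
    unfolding set_prod_def by blast
  then have "\<forall>i. \<exists>y. i < n \<longrightarrow> y \<in> I \<and> b i = \<sigma> y"
    by blast
  then obtain y where y: "\<And>i. i < n \<Longrightarrow> y i \<in> I \<and> b i = \<sigma> (y i)"
    by metis
  have "x = (\<Sum>i<n. s i * \<sigma> (y i))"
    unfolding s(2) by (rule sum.cong) (use y in auto)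
  then show "x \<in> ext_ideal S \<sigma> I"
    unfolding ext_ideal_def using s(1) y by (intro CollectI exI[of _ n] exI[of _ s] exI[of _ y]) auto
qed

lemma Int_poly_ext_eq: "Int_poly_ext D T = Int_poly D \<star> ((\<lambda>t. [:t:]) ` T)"
proof -
  have "Int_poly_ext D T = ext_ideal (Int_poly D) (\<lambda>t. [:t:]) T"
    unfolding Int_poly_ext_def ext_ideal_def ..
  then show ?thesis
    by (simp add: ext_ideal_eq)
qed

lemma subring_ofD:
  assumes "subring_of R"
  shows "0 \<in> R" "1 \<in> R" "\<And>x y. x \<in> R \<Longrightarrow> y \<in> R \<Longrightarrow> x + y \<in> R"
    "\<And>x y. x \<in> R \<Longrightarrow> y \<in> R \<Longrightarrow> x - y \<in> R" "\<And>x y. x \<in> R \<Longrightarrow> y \<in> R \<Longrightarrow> x * y \<in> R"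
  using assms unfolding subring_of_def by auto

text \<open>Encodes being an \<open>R\<close>-module as an equation. With commutativity and
  associativity of the product, most later module arguments become rewriting.\<close>

lemma set_prod_eq_submodule:
  assumes "1 \<in> R"
  shows "submodule_of R M \<longleftrightarrow> R \<star> M = M"
proof
  assume M: "submodule_of R M"
  show "R \<star> M = M"
  proof
    show "R \<star> M \<subseteq> M"
      by (rule set_prod_subset) (use M in \<open>auto simp: submodule_of_def\<close>)
    show "M \<subseteq> R \<star> M"
      using set_prod_mult[OF assms] by fastforce
  qed
next
  assume M: "R \<star> M = M"
  show "submodule_of R M"
    unfolding submodule_of_def
    using set_prod_zero[of R M] set_prod_add[of _ R M] set_prod_mult[of _ R _ M] unfolding M by blast
qed

lemma set_prod_subring:
  assumes "subring_of R"
  shows "R \<star> R = R"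
  using assms set_prod_eq_submodule[of R R]
  by (auto simp: submodule_of_def subring_of_def)

lemma subring_of_set_prod:
  assumes "subring_of R" "subring_of S"
  shows "subring_of (R \<star> S)"
proof -
  have neg: "- x \<in> R \<star> S" if "x \<in> R \<star> S" for x
    using that
  proof (induction rule: set_prod_induct)
    case (mult a b)
    then have "(0 - a) * b \<in> R \<star> S"
      using subring_ofD[OF assms(1)] by (intro set_prod_mult) blast
    then show ?case by simp
  next
    case (add x y)
    then show ?case using set_prod_add[of "-x" R S "-y"] by simp
  qed (simp add: set_prod_zero)
  have 1: "x - y \<in> R \<star> S" if "x \<in> R \<star> S" "y \<in> R \<star> S" for x y
    using set_prod_add[OF that(1) neg[OF that(2)]] by simp
  have "(R \<star> S) \<star> (R \<star> S) = (R \<star> R) \<star> (S \<star> S)"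
    by (simp add: set_prod_ac)
  then have 2: "(R \<star> S) \<star> (R \<star> S) = R \<star> S"
    using assms by (simp add: set_prod_subring)
  have "1 \<in> R \<star> S"
    using set_prod_mult[of 1 R 1 S] assms by (simp add: subring_ofD)
  then show ?thesis
    unfolding subring_of_def using 1 set_prod_zero set_prod_add set_prod_mult[of _ "R \<star> S" _ "R \<star> S"]
    by (auto simp only: 2)
qed

lemma set_prod_unit_superset: "1 \<in> J \<Longrightarrow> I \<subseteq> I \<star> J"
  using set_prod_mult[of _ I 1 J] by fastforce

lemma domain_with_qf_superset:
  assumes "domain_with_qf R" "subring_of S" "R \<subseteq> S"
  shows "domain_with_qf S"
  using assms unfolding domain_with_qf_def by blast

subsection \<open>Invertible fractional ideals\<close>

text \<open>Keeps the inverse as explicit data and says nothing about denominators, so that the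
  relation passes to localizations by mere computation. When every element of the field is a
  quotient of elements of \<open>R\<close>, a common denominator exists automatically.\<close>

definition inverse_pair :: "'a::field set \<Rightarrow> 'a set \<Rightarrow> 'a set \<Rightarrow> bool" where
  "inverse_pair R I J \<longleftrightarrow> R \<star> I = I \<and> R \<star> J = J \<and> I \<star> J = R"

lemma inverse_pair_sym: "inverse_pair R I J \<Longrightarrow> inverse_pair R J I"
  unfolding inverse_pair_def by (simp add: set_prod_commute)

lemma inverse_pair_mult:
  assumes "subring_of R" "inverse_pair R I J" "inverse_pair R I' J'"
  shows "inverse_pair R (I \<star> I') (J \<star> J')"
proof -
  have "(I \<star> I') \<star> (J \<star> J') = (I \<star> J) \<star> (I' \<star> J')"
    by (simp add: set_prod_ac)
  then show ?thesis
    using assms set_prod_subring[OF assms(1)] unfolding inverse_pair_def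
    by (auto simp flip: set_prod_assoc)
qed

lemma scale_set_prod: "((\<lambda>r. x * r) ` I) \<star> J = (\<lambda>r. x * r) ` (I \<star> J)"
proof
  show "((\<lambda>r. x * r) ` I) \<star> J \<subseteq> (\<lambda>r. x * r) ` (I \<star> J)"
  proof (rule set_prod_subset)
    show "0 \<in> (*) x ` (I \<star> J)"
      using set_prod_zero[of I J] by force
    show "u + v \<in> (*) x ` (I \<star> J)" if "u \<in> (*) x ` (I \<star> J)" "v \<in> (*) x ` (I \<star> J)" for u v
      using that by (auto simp flip: distrib_left intro: set_prod_add)
    show "u * v \<in> (*) x ` (I \<star> J)" if "u \<in> (*) x ` I" "v \<in> J" for u v
      using that by (auto simp: mult.assoc intro: set_prod_mult)
  qed
  have "x * y \<in> ((\<lambda>r. x * r) ` I) \<star> J" if "y \<in> I \<star> J" for y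
    using that
  proof (induction rule: set_prod_induct)
    case (mult a b)
    then show ?case
      using set_prod_mult[of "x * a" "(\<lambda>r. x * r) ` I" b J] by (simp add: mult.assoc)
  qed (auto intro: set_prod_zero set_prod_add simp: distrib_left)
  then show "(\<lambda>r. x * r) ` (I \<star> J) \<subseteq> ((\<lambda>r. x * r) ` I) \<star> J"
    by blast
qed

lemma scale_scale: "(\<lambda>r. x * r) ` (\<lambda>r. y * r) ` I = (\<lambda>r. (x * y) * r) ` (I :: 'a::comm_ring_1 set)"
  by (simp add: image_image mult.assoc)

lemma set_prod_scale: "I \<star> ((\<lambda>r. x * r) ` J) = (\<lambda>r. x * r) ` (I \<star> J)"
  using scale_set_prod[of x J I] by (simp add: set_prod_commute)

lemma inverse_pair_scale:
  assumes "inverse_pair R I J" "x \<noteq> 0"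
  shows "inverse_pair R ((\<lambda>r. x * r) ` I) ((\<lambda>r. inverse x * r) ` J)"
  using assms unfolding inverse_pair_def
  by (simp add: scale_set_prod set_prod_scale scale_scale)

lemma inverse_pair_principal:
  assumes "subring_of R" "x \<noteq> 0"
  shows "inverse_pair R ((\<lambda>r. x * r) ` R) ((\<lambda>r. inverse x * r) ` R)"
  using assms inverse_pair_scale[of R R R x] by (simp add: inverse_pair_def set_prod_subring)

text \<open>A nonzero j in the inverse \<open>J\<close> multiplies \<open>I\<close> into
  \<open>R\<close>; writing j = a / b with a, b in \<open>R\<close> shows that a is a common
  denominator of \<open>I\<close>.\<close>

lemma inverse_pair_frac_ideal:
  assumes R: "domain_with_qf R" and IJ: "inverse_pair R I J"
  shows "frac_ideal R I"
proof -
  have sR: "subring_of R" and qf: "\<And>k. \<exists>a\<in>R. \<exists>b\<in>R. b \<noteq> 0 \<and> k = a / b"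
    using R unfolding domain_with_qf_def by auto
  have "\<not> J \<subseteq> {0}"
  proof
    assume "J \<subseteq> {0}"
    then have "I \<star> J \<subseteq> {0}"
      by (intro set_prod_subset) auto
    then show False
      using IJ subring_ofD(2)[OF sR] unfolding inverse_pair_def by auto
  qed
  then obtain j where j: "j \<in> J" "j \<noteq> 0" by blast
  obtain a b where ab: "a \<in> R" "b \<in> R" "b \<noteq> 0" "j = a / b"
    using qf by blast
  have "a * x \<in> R" if "x \<in> I" for x
  proof -
    have "x * j \<in> R"
      using set_prod_mult[OF that j(1)] IJ unfolding inverse_pair_def by simp
    then have "b * (x * j) \<in> R"
      using ab subring_ofD[OF sR] by blast
    then show ?thesis using ab by (simp add: mult.commute)
  qed
  moreover have "a \<noteq> 0" using ab j by auto
  moreover have "submodule_of R I"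
    using IJ sR by (simp add: set_prod_eq_submodule inverse_pair_def subring_ofD)
  moreover have "I \<noteq> {0}"
  proof
    assume "I = {0}"
    then have "I \<star> J \<subseteq> {0}"
      by (intro set_prod_subset) auto
    then show False
      using IJ subring_ofD(2)[OF sR] unfolding inverse_pair_def by auto
  qed
  ultimately show ?thesis
    unfolding frac_ideal_def using ab by blast
qed

lemma inv_frac_ideal_iff:
  assumes R: "domain_with_qf R"
  shows "inv_frac_ideal R I \<longleftrightarrow> (\<exists>J. inverse_pair R I J)"
proof
  have "1 \<in> R"
    using R unfolding domain_with_qf_def by (simp add: subring_ofD)
  assume "inv_frac_ideal R I"
  then show "\<exists>J. inverse_pair R I J"
    unfolding inv_frac_ideal_def frac_ideal_def inverse_pair_def
    using set_prod_eq_submodule[OF \<open>1 \<in> R\<close>] by blast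
next
  assume "\<exists>J. inverse_pair R I J"
  then show "inv_frac_ideal R I"
    unfolding inv_frac_ideal_def
    using inverse_pair_frac_ideal[OF R] inverse_pair_sym inverse_pair_def by metis
qed

text \<open>Invertible ideals are finitely generated: the elements occurring in such an expression
  of 1 generate \<open>I\<close> and \<open>J\<close>. The passage from an ideal to finitely many
  elements rests on this.\<close>

lemma inverse_pair_finite_sum:
  assumes "subring_of R" "inverse_pair R I J"
  obtains n :: nat and a b where "\<And>i. i < n \<Longrightarrow> a i \<in> I" "\<And>i. i < n \<Longrightarrow> b i \<in> J" "(\<Sum>i<n. a i * b i) = 1"
proof -
  have "1 \<in> I \<star> J"
    using assms by (simp add: inverse_pair_def subring_ofD)
  then obtain n a b where *: "\<forall>i<n. a i \<in> I \<and> b i \<in> J" "1 = (\<Sum>i<(n::nat). a i * b i)"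
    unfolding set_prod_def by blast
  show ?thesis
    by (rule that[of n a b]) (use * in auto)
qed

section \<open>Homomorphisms and products of additive subgroups\<close>

lemma image_set_prod_hom:
  fixes h :: "'a::comm_ring_1 \<Rightarrow> 'b::comm_ring_1"
  assumes h0: "h 0 = 0" and h_add: "\<And>x y. h (x + y) = h x + h y" and h_mult: "\<And>x y. h (x * y) = h x * h y"
  shows "h ` (I \<star> J) = (h ` I) \<star> (h ` J)"
proof
  have "h x \<in> (h ` I) \<star> (h ` J)" if "x \<in> I \<star> J" for x
    using that
    by (induction rule: set_prod_induct)
       (simp_all add: set_prod_zero set_prod_add h0 h_add h_mult set_prod_mult)
  then show "h ` (I \<star> J) \<subseteq> (h ` I) \<star> (h ` J)"
    by blast
  show "(h ` I) \<star> (h ` J) \<subseteq> h ` (I \<star> J)"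
  proof (rule set_prod_subset)
    show "0 \<in> h ` (I \<star> J)"
      using set_prod_zero[of I J] h0 by (metis image_eqI)
    show "x + y \<in> h ` (I \<star> J)" if "x \<in> h ` (I \<star> J)" "y \<in> h ` (I \<star> J)" for x y
      using that set_prod_add[of _ I J] by (auto simp flip: h_add)
    show "x * y \<in> h ` (I \<star> J)" if "x \<in> h ` I" "y \<in> h ` J" for x y
      using that set_prod_mult[of _ I _ J] by (auto simp flip: h_mult)
  qed
qed

text \<open>Two instances matter: the constants K -> K(X), for ideals over Int(D), and the identity
  of K, for ideals over \<open>D\<close> itself.\<close>

locale field_embedding =
  fixes \<sigma> :: "'a::field \<Rightarrow> 'b::field"
  assumes emb_add: "\<sigma> (x + y) = \<sigma> x + \<sigma> y"
    and emb_mult: "\<sigma> (x * y) = \<sigma> x * \<sigma> y"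
    and emb_one [simp]: "\<sigma> 1 = 1"
begin

lemma emb_zero [simp]: "\<sigma> 0 = 0"
proof (rule add_left_imp_eq)
  show "\<sigma> 0 + \<sigma> 0 = \<sigma> 0 + 0"
    by (simp flip: emb_add)
qed

lemma emb_diff: "\<sigma> (x - y) = \<sigma> x - \<sigma> y"
  using emb_add[of "x - y" y] by simp

lemma emb_eq_0_iff [simp]: "\<sigma> x = 0 \<longleftrightarrow> x = 0"
proof
  assume "\<sigma> x = 0"
  then have "\<sigma> (x * inverse x) = 0"
    by (simp only: emb_mult mult_zero_left)
  then show "x = 0"
    by (cases "x = 0") simp_all
qed simp

lemma emb_inverse: "\<sigma> (inverse x) = inverse (\<sigma> x)"
proof (cases "x = 0")
  case False
  then have "\<sigma> x * \<sigma> (inverse x) = 1"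
    by (simp flip: emb_mult)
  then show ?thesis
    by (simp add: inverse_unique)
qed simp

lemma image_set_prod: "\<sigma> ` (I \<star> J) = (\<sigma> ` I) \<star> (\<sigma> ` J)"
  by (rule image_set_prod_hom) (simp_all add: emb_add emb_mult)

lemma subring_of_image:
  assumes "subring_of R"
  shows "subring_of (\<sigma> ` R)"
  unfolding subring_of_def
proof (intro conjI ballI)
  show "0 \<in> \<sigma> ` R" "1 \<in> \<sigma> ` R"
    using subring_ofD(1,2)[OF assms] emb_zero emb_one by (metis image_eqI)+
qed (use subring_ofD(3-5)[OF assms] in \<open>auto simp flip: emb_add emb_diff emb_mult\<close>)

end

lemma field_embedding_id: "field_embedding (\<lambda>x. x)"
  by unfold_locales auto

subsection \<open>Quotients of Picard groups\<close>

lemma Inv_group_simps [simp]: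
  "carrier (Inv_group R) = {I. inv_frac_ideal R I}"
  "I \<otimes>\<^bsub>Inv_group R\<^esub> J = I \<star> J"
  "\<one>\<^bsub>Inv_group R\<^esub> = R"
  by (simp_all add: Inv_group_def)

lemma comm_group_Inv_group:
  assumes R: "domain_with_qf R"
  shows "comm_group (Inv_group R)"
proof (rule comm_groupI; simp add: inv_frac_ideal_iff[OF R])
  have sR: "subring_of R"
    using R by (simp add: domain_with_qf_def)
  show "\<exists>K. inverse_pair R (I \<star> J) K" if "\<exists>K. inverse_pair R I K" "\<exists>K. inverse_pair R J K" for I J
    using that inverse_pair_mult[OF sR] by blast
  show "\<exists>J. inverse_pair R R J"
    using set_prod_subring[OF sR] by (auto simp: inverse_pair_def)
  show "R \<star> I = I" if "\<exists>J. inverse_pair R I J" for I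
    using that by (auto simp: inverse_pair_def)
  show "\<exists>J. (\<exists>K. inverse_pair R J K) \<and> J \<star> I = R" if inv: "\<exists>J. inverse_pair R I J" for I
  proof -
    obtain J where "inverse_pair R I J"
      using inv by blast
    then have "inverse_pair R J I \<and> J \<star> I = R"
      using inverse_pair_sym[of R I J] unfolding inverse_pair_def by blast
    then show ?thesis by blast
  qed
qed (simp_all add: set_prod_ac)

lemma inv_Inv_group:
  assumes "domain_with_qf R" "inverse_pair R I J"
  shows "inv\<^bsub>Inv_group R\<^esub> I = J"
proof -
  interpret comm_group "Inv_group R"
    using assms(1) by (rule comm_group_Inv_group)
  have "inverse_pair R J I"
    using assms(2) by (rule inverse_pair_sym)
  then show ?thesis
    using assms by (intro inv_equality) (auto simp: inv_frac_ideal_iff inverse_pair_def)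
qed

lemma subgroup_principal_frac:
  assumes R: "domain_with_qf R"
  shows "subgroup (principal_frac R) (Inv_group R)"
proof -
  interpret comm_group "Inv_group R"
    using R by (rule comm_group_Inv_group)
  have sR: "subring_of R"
    using R by (simp add: domain_with_qf_def)
  show ?thesis
  proof (rule subgroupI)
    show "principal_frac R \<subseteq> carrier (Inv_group R)"
      using inverse_pair_principal[OF sR] by (auto simp: principal_frac_def inv_frac_ideal_iff[OF R])
    show "principal_frac R \<noteq> {}"
      unfolding principal_frac_def by (auto intro: exI[of _ 1])
    show "inv\<^bsub>Inv_group R\<^esub> I \<in> principal_frac R" if I: "I \<in> principal_frac R" for I
    proof -
      obtain x where x: "x \<noteq> 0" "I = (\<lambda>r. x * r) ` R"
        using I unfolding principal_frac_def by blast
      have "inv\<^bsub>Inv_group R\<^esub> I = (\<lambda>r. inverse x * r) ` R"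
        unfolding x(2) by (rule inv_Inv_group[OF R inverse_pair_principal[OF sR x(1)]])
      then show ?thesis
        using x(1) unfolding principal_frac_def by (intro CollectI exI[of _ "inverse x"]) simp
    qed
    show "I \<otimes>\<^bsub>Inv_group R\<^esub> J \<in> principal_frac R"
      if IJ: "I \<in> principal_frac R" "J \<in> principal_frac R" for I J
    proof -
      obtain x y where "x \<noteq> 0" "I = (\<lambda>r. x * r) ` R" "y \<noteq> 0" "J = (\<lambda>r. y * r) ` R"
        using IJ unfolding principal_frac_def by blast
      then show ?thesis
        unfolding principal_frac_def
        by (intro CollectI exI[of _ "y * x"])
           (simp add: scale_set_prod set_prod_scale scale_scale set_prod_subring[OF sR])
    qed
  qed
qed

lemma (in group) r_coset_eq_iff:
  assumes "subgroup H G" "x \<in> carrier G" "y \<in> carrier G"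
  shows "H #> x = H #> y \<longleftrightarrow> (\<exists>h\<in>H. y = h \<otimes> x)"
proof
  assume "H #> x = H #> y"
  then have "y \<in> H #> x"
    using rcos_self[OF assms(3,1)] by simp
  then show "\<exists>h\<in>H. y = h \<otimes> x"
    unfolding r_coset_def by auto
next
  assume "\<exists>h\<in>H. y = h \<otimes> x"
  then have "y \<in> H #> x"
    unfolding r_coset_def by auto
  then show "H #> x = H #> y"
    using assms by (rule_tac repr_independence) auto
qed

text \<open>Both arrows of the sequence are given on ideals rather than on classes. Surjectivity of
  \<open>\<psi>\<close> supplies representatives and the fibre condition makes the value independent
  of them; \<open>P\<close> enters as a set closed under an operation, so that sets of ideals under
  multiplication qualify.\<close>

lemma induced_hom:
  assumes \<psi>: "\<psi> ` P = carrier A" and \<phi>: "\<phi> ` P \<subseteq> carrier B"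
    and closed: "\<And>x y. x \<in> P \<Longrightarrow> y \<in> P \<Longrightarrow> m x y \<in> P"
    and \<psi>_m: "\<And>x y. x \<in> P \<Longrightarrow> y \<in> P \<Longrightarrow> \<psi> (m x y) = \<psi> x \<otimes>\<^bsub>A\<^esub> \<psi> y"
    and \<phi>_m: "\<And>x y. x \<in> P \<Longrightarrow> y \<in> P \<Longrightarrow> \<phi> (m x y) = \<phi> x \<otimes>\<^bsub>B\<^esub> \<phi> y"
    and fibre: "\<And>x y. x \<in> P \<Longrightarrow> y \<in> P \<Longrightarrow> \<psi> x = \<psi> y \<Longrightarrow> \<phi> x = \<phi> y"
  obtains f where "f \<in> hom A B" "\<And>x. x \<in> P \<Longrightarrow> f (\<psi> x) = \<phi> x"
proof
  define f where "f = (\<lambda>a. \<phi> (SOME x. x \<in> P \<and> \<psi> x = a))"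
  show f: "f (\<psi> x) = \<phi> x" if "x \<in> P" for x
  proof -
    have "(SOME y. y \<in> P \<and> \<psi> y = \<psi> x) \<in> P \<and> \<psi> (SOME y. y \<in> P \<and> \<psi> y = \<psi> x) = \<psi> x"
      by (rule someI[of _ x]) (use that in auto)
    then show ?thesis
      unfolding f_def using fibre that by blast
  qed
  show "f \<in> hom A B"
  proof (rule homI)
    show "f a \<in> carrier B" if a: "a \<in> carrier A" for a
    proof -
      obtain x where "x \<in> P" "a = \<psi> x" using a \<psi> by blast
      then show ?thesis using f \<phi> by auto
    qed
    show "f (a \<otimes>\<^bsub>A\<^esub> b) = f a \<otimes>\<^bsub>B\<^esub> f b" if ab: "a \<in> carrier A" "b \<in> carrier A" for a b
    proof -
      obtain x y where "x \<in> P" "a = \<psi> x" "y \<in> P" "b = \<psi> y" using ab \<psi> by blast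
      then show ?thesis
        using f[of x] f[of y] f[of "m x y"] \<psi>_m[of x y] \<phi>_m[of x y] closed[of x y] by simp
    qed
  qed
qed

section \<open>Classes in the two-step quotient Pic(S) / Pic(A)\<close>

definition quot_class :: "'a::field set \<Rightarrow> 'b::field set \<Rightarrow> ('a \<Rightarrow> 'b) \<Rightarrow> 'b set \<Rightarrow> 'b set set set" where
  "quot_class A S \<sigma> I = iota_image A S \<sigma> #>\<^bsub>Pic S\<^esub> pic_class S I"

text \<open>Used for \<open>D\<close> with Int(D), and for each member T of the family with
  Int(D)T.\<close>

locale pic_extension = field_embedding \<sigma> for \<sigma> :: "'a::field \<Rightarrow> 'b::field" +
  fixes A :: "'a set" and S :: "'b set"
  assumes qf_base: "domain_with_qf A" and qf_ext: "domain_with_qf S" and emb_subset: "\<sigma> ` A \<subseteq> S"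
begin

lemma subring_base: "subring_of A" and subring_ext: "subring_of S"
  using qf_base qf_ext by (auto simp: domain_with_qf_def)

lemma inverse_pair_ext_ideal:
  assumes "inverse_pair A I J"
  shows "inverse_pair S (ext_ideal S \<sigma> I) (ext_ideal S \<sigma> J)"
proof -
  have "S \<star> \<sigma> ` A = S"
  proof
    show "S \<star> \<sigma> ` A \<subseteq> S"
      using set_prod_mono[OF subset_refl emb_subset, of S] set_prod_subring[OF subring_ext] by simp
    show "S \<subseteq> S \<star> \<sigma> ` A"
      using subring_ofD(2)[OF subring_of_image[OF subring_base]] by (rule set_prod_unit_superset)
  qed
  moreover have "(S \<star> \<sigma> ` I) \<star> (S \<star> \<sigma> ` J) = (S \<star> S) \<star> \<sigma> ` (I \<star> J)"
    by (simp add: image_set_prod set_prod_ac)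
  ultimately show ?thesis
    using assms unfolding inverse_pair_def ext_ideal_eq
    by (simp add: set_prod_subring[OF subring_ext] flip: set_prod_assoc)
qed

sublocale IS: comm_group "Inv_group S"
  by (rule comm_group_Inv_group[OF qf_ext])

lemma normal_principal: "principal_frac S \<lhd> Inv_group S"
  by (rule IS.subgroup_imp_normal[OF subgroup_principal_frac[OF qf_ext]])

sublocale PS: comm_group "Pic S"
  unfolding Pic_def by (rule IS.abelian_FactGroup[OF subgroup_principal_frac[OF qf_ext]])

lemma pic_class_hom: "pic_class S \<in> hom (Inv_group S) (Pic S)"
  unfolding Pic_def pic_class_def[abs_def] by (rule normal.r_coset_hom_Mod[OF normal_principal])

lemma pic_class_carrier: "pic_class S ` carrier (Inv_group S) = carrier (Pic S)"
  unfolding Pic_def pic_class_def[abs_def] carrier_FactGroup ..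

lemma subgroup_ext_ideals: "subgroup {ext_ideal S \<sigma> I | I. inv_frac_ideal A I} (Inv_group S)"
proof (rule IS.subgroupI)
  have sA: "subring_of A"
    using qf_base by (simp add: domain_with_qf_def)
  show "{ext_ideal S \<sigma> I | I. inv_frac_ideal A I} \<subseteq> carrier (Inv_group S)"
    using inverse_pair_ext_ideal by (auto simp: inv_frac_ideal_iff[OF qf_base] inv_frac_ideal_iff[OF qf_ext])
  have "inv_frac_ideal A A"
    using set_prod_subring[OF sA] by (auto simp: inv_frac_ideal_iff[OF qf_base] inverse_pair_def)
  then show "{ext_ideal S \<sigma> I | I. inv_frac_ideal A I} \<noteq> {}"
    by blast
  show "inv\<^bsub>Inv_group S\<^esub> E \<in> {ext_ideal S \<sigma> I | I. inv_frac_ideal A I}"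
    if E: "E \<in> {ext_ideal S \<sigma> I | I. inv_frac_ideal A I}" for E
  proof -
    obtain I J where I: "E = ext_ideal S \<sigma> I" "inverse_pair A I J"
      using E by (auto simp: inv_frac_ideal_iff[OF qf_base])
    have "inv\<^bsub>Inv_group S\<^esub> E = ext_ideal S \<sigma> J"
      unfolding I(1) by (rule inv_Inv_group[OF qf_ext inverse_pair_ext_ideal[OF I(2)]])
    moreover have "inv_frac_ideal A J"
      using inverse_pair_sym[OF I(2)] by (auto simp: inv_frac_ideal_iff[OF qf_base])
    ultimately show ?thesis by blast
  qed
  show "E \<otimes>\<^bsub>Inv_group S\<^esub> E' \<in> {ext_ideal S \<sigma> I | I. inv_frac_ideal A I}"
    if EE': "E \<in> {ext_ideal S \<sigma> I | I. inv_frac_ideal A I}" "E' \<in> {ext_ideal S \<sigma> I | I. inv_frac_ideal A I}"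
    for E E'
  proof -
    obtain I J where I: "E = ext_ideal S \<sigma> I" "inv_frac_ideal A I"
        and J: "E' = ext_ideal S \<sigma> J" "inv_frac_ideal A J"
      using EE' by blast
    have "(S \<star> \<sigma> ` I) \<star> (S \<star> \<sigma> ` J) = (S \<star> S) \<star> \<sigma> ` (I \<star> J)"
      by (simp add: image_set_prod set_prod_ac)
    then have "E \<star> E' = ext_ideal S \<sigma> (I \<star> J)"
      unfolding I(1) J(1) ext_ideal_eq by (simp add: set_prod_subring[OF subring_ext])
    moreover have "inv_frac_ideal A (I \<star> J)"
      using I(2) J(2) inverse_pair_mult[OF sA] by (meson inv_frac_ideal_iff[OF qf_base])
    ultimately show ?thesis by auto
  qed
qed

lemma subgroup_iota_image: "subgroup (iota_image A S \<sigma>) (Pic S)"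
proof -
  interpret group_hom "Inv_group S" "Pic S" "pic_class S"
    using pic_class_hom by unfold_locales
  have "iota_image A S \<sigma> = pic_class S ` {ext_ideal S \<sigma> I | I. inv_frac_ideal A I}"
    unfolding iota_image_def by auto
  then show ?thesis
    using subgroup_img_is_subgroup[OF subgroup_ext_ideals] by simp
qed

sublocale PQ: comm_group "Pic_quot A S \<sigma>"
  unfolding Pic_quot_def by (rule PS.abelian_FactGroup[OF subgroup_iota_image])

lemma group_Pic_quot: "group (Pic_quot A S \<sigma>)"
  by (rule PQ.is_group)

lemma quot_class_hom: "quot_class A S \<sigma> \<in> hom (Inv_group S) (Pic_quot A S \<sigma>)"
proof -
  have "(\<lambda>a. iota_image A S \<sigma> #>\<^bsub>Pic S\<^esub> a) \<in> hom (Pic S) (Pic_quot A S \<sigma>)"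
    unfolding Pic_quot_def
    by (rule normal.r_coset_hom_Mod[OF PS.subgroup_imp_normal[OF subgroup_iota_image]])
  from hom_compose[OF pic_class_hom this] show ?thesis
    by (simp add: quot_class_def[abs_def] comp_def)
qed

lemma quot_class_carrier: "quot_class A S \<sigma> ` carrier (Inv_group S) = carrier (Pic_quot A S \<sigma>)"
  unfolding Pic_quot_def carrier_FactGroup pic_class_carrier[symmetric] quot_class_def image_image ..

lemma quot_class_mult:
  "inv_frac_ideal S I \<Longrightarrow> inv_frac_ideal S J \<Longrightarrow>
   quot_class A S \<sigma> (I \<star> J) = quot_class A S \<sigma> I \<otimes>\<^bsub>Pic_quot A S \<sigma>\<^esub> quot_class A S \<sigma> J"
  using hom_mult[OF quot_class_hom, of I J] by simp

lemma quot_class_one: "quot_class A S \<sigma> S = \<one>\<^bsub>Pic_quot A S \<sigma>\<^esub>"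
  using hom_one[OF quot_class_hom IS.is_group PQ.is_group] by simp

text \<open>Unwinds both quotients at once: the principal ideals contribute the scalar x, the image
  of Pic(A) contributes the ideal \<open>B\<close>. Later arguments see classes only through this
  description.\<close>

lemma quot_class_eq_iff:
  assumes I: "inv_frac_ideal S I" and J: "inv_frac_ideal S J"
  shows "quot_class A S \<sigma> I = quot_class A S \<sigma> J \<longleftrightarrow>
    (\<exists>x B. x \<noteq> 0 \<and> inv_frac_ideal A B \<and> J = (\<lambda>r. x * r) ` (I \<star> \<sigma> ` B))"
proof -
  have pc: "pic_class S I \<in> carrier (Pic S)" if "inv_frac_ideal S I" for I
    using that pic_class_carrier by auto
  have ext: "inv_frac_ideal S (ext_ideal S \<sigma> B)" if "inv_frac_ideal A B" for B
    using that inverse_pair_ext_ideal by (auto simp: inv_frac_ideal_iff[OF qf_base] inv_frac_ideal_iff[OF qf_ext])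
  have SI: "S \<star> I = I"
    using I by (auto simp: inv_frac_ideal_iff[OF qf_ext] inverse_pair_def)
  have "quot_class A S \<sigma> I = quot_class A S \<sigma> J \<longleftrightarrow>
    (\<exists>h\<in>iota_image A S \<sigma>. pic_class S J = h \<otimes>\<^bsub>Pic S\<^esub> pic_class S I)"
    unfolding quot_class_def by (rule PS.r_coset_eq_iff[OF subgroup_iota_image pc[OF I] pc[OF J]])
  also have "\<dots> \<longleftrightarrow> (\<exists>B. inv_frac_ideal A B \<and>
       pic_class S J = pic_class S (ext_ideal S \<sigma> B) \<otimes>\<^bsub>Pic S\<^esub> pic_class S I)"
    unfolding iota_image_def by blast
  also have "\<dots> \<longleftrightarrow> (\<exists>B. inv_frac_ideal A B \<and> (\<exists>x. x \<noteq> 0 \<and> J = (\<lambda>r. x * r) ` (I \<star> \<sigma> ` B)))"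
  proof (intro ex_cong1 conj_cong refl)
    fix B assume B: "inv_frac_ideal A B"
    let ?E = "ext_ideal S \<sigma> B"
    have E: "?E \<star> I \<in> carrier (Inv_group S)"
      using IS.m_closed[of ?E I] ext[OF B] I by simp
    \<comment> \<open>The factors \<open>S\<close> coming from the principal ideal and from
      \<open>ext_ideal\<close> are absorbed by \<open>S \<star> I = I\<close>.\<close>
    have EI: "S \<star> (?E \<star> I) = I \<star> \<sigma> ` B"
    proof -
      have "S \<star> (?E \<star> I) = (S \<star> S) \<star> I \<star> \<sigma> ` B"
        by (simp add: ext_ideal_eq set_prod_ac)
      then show ?thesis
        using SI by (simp add: set_prod_subring[OF subring_ext])
    qed
    have "pic_class S ?E \<otimes>\<^bsub>Pic S\<^esub> pic_class S I = pic_class S (?E \<star> I)"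
      using hom_mult[OF pic_class_hom, of ?E I] ext[OF B] I by simp
    then have "pic_class S J = pic_class S ?E \<otimes>\<^bsub>Pic S\<^esub> pic_class S I
        \<longleftrightarrow> pic_class S (?E \<star> I) = pic_class S J"
      by auto
    also have "\<dots> \<longleftrightarrow> (\<exists>h\<in>principal_frac S. J = h \<otimes>\<^bsub>Inv_group S\<^esub> (?E \<star> I))"
      unfolding pic_class_def
      by (rule IS.r_coset_eq_iff[OF subgroup_principal_frac[OF qf_ext] E]) (use J in simp)
    also have "\<dots> \<longleftrightarrow> (\<exists>x. x \<noteq> 0 \<and> J = (\<lambda>r. x * r) ` (I \<star> \<sigma> ` B))"
      unfolding principal_frac_def by (auto simp: scale_set_prod EI)
    finally show "pic_class S J = pic_class S ?E \<otimes>\<^bsub>Pic S\<^esub> pic_class S I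
        \<longleftrightarrow> (\<exists>x. x \<noteq> 0 \<and> J = (\<lambda>r. x * r) ` (I \<star> \<sigma> ` B))" .
  qed
  finally show ?thesis by blast
qed

end

subsection \<open>Localization at flat overrings\<close>

text \<open>The ideals \<open>I\<close> with \<open>1 \<in> I \<star> T\<close> form a Gabriel filter, and a flat overring \<open>T\<close> behaves
  like the localization at this filter: membership in \<open>M \<star> \<sigma> ` T\<close> is tested by the
  ideal of those \<open>c \<in> D\<close> which move the element into \<open>M\<close>.\<close>

definition dense_in :: "'a::field set \<Rightarrow> 'a set \<Rightarrow> bool" where
  "dense_in I T \<longleftrightarrow> 1 \<in> I \<star> T"

lemma dense_in_mono: "dense_in I T \<Longrightarrow> I \<subseteq> J \<Longrightarrow> dense_in J T"
  unfolding dense_in_def using set_prod_mono[of I J T T] by blast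

text \<open>Expand 1 = 1 * 1 along both expressions of 1. Each product c d of elements of the two
  sets satisfies both predicates, by their stability under multiplication by
  \<open>D\<close>.\<close>

lemma dense_in_Int:
  assumes D: "subring_of D" and T: "subring_of T" and I: "dense_in {c\<in>D. P c} T" and J: "dense_in {c\<in>D. Q c} T"
    and P: "\<And>c d. c \<in> D \<Longrightarrow> d \<in> D \<Longrightarrow> P c \<Longrightarrow> P (c * d)"
    and Q: "\<And>c d. c \<in> D \<Longrightarrow> d \<in> D \<Longrightarrow> Q c \<Longrightarrow> Q (c * d)"
  shows "dense_in {c\<in>D. P c \<and> Q c} T"
proof -
  let ?I = "{c\<in>D. P c}" and ?J = "{c\<in>D. Q c}" and ?K = "{c\<in>D. P c \<and> Q c}"
  have "1 * 1 \<in> (?I \<star> T) \<star> (?J \<star> T)"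
    using I J unfolding dense_in_def by (rule set_prod_mult)
  then have "1 \<in> (?I \<star> ?J) \<star> (T \<star> T)"
    by (simp add: set_prod_ac)
  moreover have "(?I \<star> ?J) \<star> (T \<star> T) \<subseteq> (?K \<star> T) \<star> T"
  proof -
    have "?I \<star> ?J \<star> T \<subseteq> ?K \<star> T"
    proof (rule set_prod_subset)
      fix x t assume x: "x \<in> ?I \<star> ?J" and t: "t \<in> T"
      from x show "x * t \<in> ?K \<star> T"
      proof (induction rule: set_prod_induct)
        case (mult c d)
        then show ?case
          using t P[of c d] Q[of d c] subring_ofD(5)[OF D, of c d] by (intro set_prod_mult) (auto simp: mult.commute)
      qed (simp_all add: set_prod_zero set_prod_add distrib_right)
    qed (simp_all add: set_prod_zero set_prod_add)
    then show ?thesis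
      by (simp add: set_prod_mono flip: set_prod_assoc)
  qed
  ultimately have "1 \<in> ?K \<star> (T \<star> T)"
    by (auto simp: set_prod_assoc)
  then show ?thesis
    unfolding dense_in_def by (simp add: set_prod_subring[OF T])
qed

text \<open>This is where finiteness of exceptional sets, and of sets of generators, becomes usable:
  finitely many conditions on c can be imposed together.\<close>

lemma dense_in_Ball:
  assumes D: "subring_of D" and T: "subring_of T" "D \<subseteq> T" and fin: "finite X"
    and dense: "\<And>x. x \<in> X \<Longrightarrow> dense_in {c\<in>D. P x c} T"
    and P: "\<And>x c d. x \<in> X \<Longrightarrow> c \<in> D \<Longrightarrow> d \<in> D \<Longrightarrow> P x c \<Longrightarrow> P x (c * d)"
  shows "dense_in {c\<in>D. \<forall>x\<in>X. P x c} T"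
  using fin dense P
proof (induction X rule: finite_induct)
  case empty
  show ?case
    unfolding dense_in_def using set_prod_mult[of 1 D 1 T] subring_ofD(2)[OF D] subring_ofD(2)[OF T(1)] by simp
next
  case (insert x X)
  have "dense_in {c\<in>D. P x c \<and> (\<forall>x\<in>X. P x c)} T"
    by (rule dense_in_Int[OF D T(1)]) (use insert in auto)
  then show ?case by simp
qed

text \<open>Apply the equational criterion to the single relation b t - a 1 = 0, where t = a / b. It
  yields b \<open>A 0 j\<close> = a \<open>A 1 j\<close>, so each \<open>A 1 j\<close> moves t to
  the element \<open>A 0 j\<close> of \<open>D\<close>, while the row belonging to 1 writes 1 as the
  sum of the products \<open>A 1 j * m' j\<close>.\<close>

lemma flat_dense_in:
  assumes D: "domain_with_qf D" and T: "flat_overring D T" and t: "t \<in> T"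
  shows "dense_in {c\<in>D. c * t \<in> D} T"
proof -
  obtain a b where ab: "a \<in> D" "b \<in> D" "b \<noteq> 0" "t = a / b"
    using D unfolding domain_with_qf_def by blast
  have sD: "subring_of D" and sT: "subring_of T"
    using D T by (auto simp: domain_with_qf_def flat_overring_def overring_def)
  \<comment> \<open>Index 0 carries t with coefficient b, index 1 carries 1 with coefficient -a,
    written \<open>0 - a\<close> because \<open>subring_of\<close> speaks of differences.\<close>
  define r where "r = (\<lambda>i::nat. if i = 0 then b else 0 - a)"
  define m where "m = (\<lambda>i::nat. if i = 0 then t else 1)"
  have "(\<forall>i<2. r i \<in> D \<and> m i \<in> T) \<and> (\<Sum>i<2. r i * m i) = 0"
    using ab t subring_ofD(4)[OF sD, of 0 a] subring_ofD(1)[OF sD] subring_ofD(2)[OF sT]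
    by (auto simp: r_def m_def numeral_2_eq_2)
  then obtain p :: nat and A m' where
    A: "\<forall>i<2. \<forall>j<p. A i j \<in> D" "\<forall>j<p. m' j \<in> T" "\<forall>i<2. m i = (\<Sum>j<p. A i j * m' j)"
      "\<forall>j<p. (\<Sum>i<2. r i * A i j) = 0"
    using T[unfolded flat_overring_def flat_over_def, THEN conjunct2, THEN spec, THEN spec, THEN spec, THEN mp, of 2 r m]
    by blast
  have "A 1 j * t \<in> D" if "j < p" for j
  proof -
    have "b * A 0 j = a * A 1 j"
      using A(4) that by (auto simp: r_def numeral_2_eq_2)
    then have "b * (A 1 j * t) = b * A 0 j"
      using ab(3,4) by (simp add: mult.commute)
    then have "A 1 j * t = A 0 j"
      using ab(3) by simp
    then show ?thesis using A(1) that by simp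
  qed
  then have "(\<Sum>j<p. A 1 j * m' j) \<in> {c\<in>D. c * t \<in> D} \<star> T"
    unfolding set_prod_def using A(1,2)
    by (intro CollectI exI[of _ p] exI[of _ "A 1"] exI[of _ m']) auto
  then show ?thesis
    unfolding dense_in_def using A(3)[rule_format, of 1] by (simp add: m_def)
qed

context field_embedding
begin

text \<open>The conductor of y into \<open>M\<close>, taken inside \<open>D\<close>.\<close>

definition colon :: "'a set \<Rightarrow> 'b set \<Rightarrow> 'b \<Rightarrow> 'a set" where
  "colon D M y = {c\<in>D. \<sigma> c * y \<in> M}"

text \<open>A generator m \<sigma>(t) is moved into \<open>M\<close> by every c with c t in
  \<open>D\<close>, and these c are dense by flatness; sums are handled by intersecting. Conversely,
  if 1 = \<Sum> c_i t_i with all \<sigma>(c_i) y in \<open>M\<close>, then y = \<Sum> (\<sigma>(c_i)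
  y) \<sigma>(t_i).\<close>

lemma mem_localization_iff:
  assumes D: "domain_with_qf D" and T: "flat_overring D T" and M: "\<sigma> ` D \<star> M = M"
  shows "y \<in> M \<star> \<sigma> ` T \<longleftrightarrow> dense_in (colon D M y) T"
proof
  have sD: "subring_of D" and sT: "subring_of T" and DT: "D \<subseteq> T"
    using D T by (auto simp: domain_with_qf_def flat_overring_def overring_def)
  have M0: "0 \<in> M" and Madd: "\<And>x y. x \<in> M \<Longrightarrow> y \<in> M \<Longrightarrow> x + y \<in> M"
    and Mmult: "\<And>c y. c \<in> D \<Longrightarrow> y \<in> M \<Longrightarrow> \<sigma> c * y \<in> M"
    using set_prod_zero[of "\<sigma> ` D" M] set_prod_add[of _ "\<sigma> ` D" M] set_prod_mult[of _ "\<sigma> ` D" _ M]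
    unfolding M by auto
  have Mmult': "\<And>c d y. d \<in> D \<Longrightarrow> \<sigma> c * y \<in> M \<Longrightarrow> \<sigma> (c * d) * y \<in> M"
    using Mmult by (metis emb_mult mult.assoc mult.commute)
  show "dense_in (colon D M y) T" if "y \<in> M \<star> \<sigma> ` T"
    using that
  proof (induction rule: set_prod_induct)
    case zero
    then show ?case
      unfolding dense_in_def colon_def
      using set_prod_mult[of 1 D 1 T] subring_ofD(2)[OF sD] subring_ofD(2)[OF sT] M0 by simp
  next
    case (add x y)
    then have "dense_in {c\<in>D. \<sigma> c * x \<in> M \<and> \<sigma> c * y \<in> M} T"
      unfolding colon_def by (rule dense_in_Int[OF sD sT]) (auto intro: Mmult')
    then show ?case
      by (rule dense_in_mono) (auto simp: colon_def distrib_left intro: Madd)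
  next
    case (mult a b)
    then obtain t where t: "t \<in> T" "b = \<sigma> t" by blast
    have "c \<in> colon D M (a * b)" if "c \<in> D" "c * t \<in> D" for c
      using Mmult[OF that(2) mult(1)] that(1) by (simp add: colon_def t emb_mult mult_ac)
    then have "{c\<in>D. c * t \<in> D} \<subseteq> colon D M (a * b)"
      by blast
    then show ?case
      using flat_dense_in[OF D T t(1)] dense_in_mono by blast
  qed
  show "y \<in> M \<star> \<sigma> ` T" if "dense_in (colon D M y) T"
  proof -
    have "\<sigma> x * y \<in> M \<star> \<sigma> ` T" if "x \<in> colon D M y \<star> T" for x
      using that
    proof (induction rule: set_prod_induct)
      case (mult c t)
      then have "(\<sigma> c * y) * \<sigma> t \<in> M \<star> \<sigma> ` T"
        by (intro set_prod_mult) (auto simp: colon_def)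
      then show ?case by (simp add: emb_mult mult_ac)
    qed (simp_all add: set_prod_zero set_prod_add emb_add distrib_right)
    from this[of 1] show ?thesis
      using that unfolding dense_in_def by simp
  qed
qed

end

lemma mem_localization_base_iff:
  assumes "domain_with_qf D" "flat_overring D T" "D \<star> M = M"
  shows "y \<in> M \<star> T \<longleftrightarrow> dense_in {c\<in>D. c * y \<in> M} T"
proof -
  interpret field_embedding "\<lambda>x. x"
    by (rule field_embedding_id)
  show ?thesis
    using mem_localization_iff[of D T M y] assms by (simp add: colon_def)
qed

section \<open>Completeness and independence in terms of conductors\<close>

lemma pre_jaffardD:
  assumes "pre_jaffard D \<Theta>"
  shows "T \<in> \<Theta> \<Longrightarrow> flat_overring D T"
    and "T \<in> \<Theta> \<Longrightarrow> subring_of T"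
    and "T \<in> \<Theta> \<Longrightarrow> D \<subseteq> T"
    and "T \<in> \<Theta> \<Longrightarrow> S \<in> \<Theta> \<Longrightarrow> T \<noteq> S \<Longrightarrow> T \<star> S = UNIV"
proof -
  have flat: "\<forall>T\<in>\<Theta>. flat_overring D T"
    using assms unfolding pre_jaffard_def by (elim conjE)
  have indep: "\<forall>T\<in>\<Theta>. \<forall>T'\<in>\<Theta>. T \<noteq> T' \<longrightarrow> T \<star> T' = UNIV"
    using assms unfolding pre_jaffard_def by (elim conjE)
  show "T \<in> \<Theta> \<Longrightarrow> flat_overring D T" "T \<in> \<Theta> \<Longrightarrow> subring_of T" "T \<in> \<Theta> \<Longrightarrow> D \<subseteq> T"
    using flat by (simp_all add: flat_overring_def overring_def)
  show "T \<in> \<Theta> \<Longrightarrow> S \<in> \<Theta> \<Longrightarrow> T \<noteq> S \<Longrightarrow> T \<star> S = UNIV"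
    using indep by blast
qed

text \<open>Completeness enters the development through this lemma. It is applied to ideals of
  conductor type, so that a membership known in every localization holds globally.\<close>

lemma pre_jaffard_one_mem:
  assumes "pre_jaffard D \<Theta>" "ideal_of D I" "\<And>T. T \<in> \<Theta> \<Longrightarrow> dense_in I T"
  shows "1 \<in> I"
proof -
  have "\<forall>I. ideal_of D I \<longrightarrow> I = (\<Inter>T\<in>\<Theta>. ext_ideal T id I)"
    using assms(1) unfolding pre_jaffard_def by (elim conjE)
  from this[THEN spec, THEN mp, OF assms(2)] have "I = (\<Inter>T\<in>\<Theta>. ext_ideal T id I)" .
  moreover have "1 \<in> ext_ideal T id I" if "T \<in> \<Theta>" for T
    using assms(3)[OF that] by (simp add: ext_ideal_eq dense_in_def set_prod_commute)
  ultimately show ?thesis by blast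
qed

lemma overring_module:
  assumes "subring_of D" "subring_of T" "D \<subseteq> T"
  shows "D \<star> T = T"
  using set_prod_unit_superset[OF subring_ofD(2)[OF assms(1)], of T] set_prod_mono[OF assms(3) subset_refl, of T]
    set_prod_subring[OF assms(2)] by (auto simp: set_prod_commute)

text \<open>Kept apart from the pointed situation because it is also instantiated with an auxiliary
  Jaffard family of \<open>D\<close>, which may differ from the given family.\<close>

locale complete_family =
  fixes D :: "'a::field set" and \<Theta> :: "'a set set"
  assumes qf: "domain_with_qf D" and pj: "pre_jaffard D \<Theta>"
begin

lemmas flat = pre_jaffardD(1)[OF pj]
lemmas subring_mem = pre_jaffardD(2)[OF pj]
lemmas base_subset = pre_jaffardD(3)[OF pj]
lemmas independent = pre_jaffardD(4)[OF pj]

lemma subring_base: "subring_of D"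
  using qf by (simp add: domain_with_qf_def)

lemma base_module: "T \<in> \<Theta> \<Longrightarrow> D \<star> T = T"
  by (rule overring_module[OF subring_base subring_mem base_subset])

text \<open>By flatness the conductor of x into \<open>D\<close> is dense in each member containing
  x, so completeness puts 1 into it. Thus \<open>D\<close> is the intersection of the
  family.\<close>

lemma mem_baseI:
  assumes "\<And>T. T \<in> \<Theta> \<Longrightarrow> x \<in> T"
  shows "x \<in> D"
proof -
  have "1 \<in> {c\<in>D. c * x \<in> D}"
  proof (rule pre_jaffard_one_mem[OF pj])
    show "ideal_of D {c\<in>D. c * x \<in> D}"
      unfolding ideal_of_def using subring_ofD[OF subring_base] by (auto simp: distrib_right mult.assoc)
    show "dense_in {c\<in>D. c * x \<in> D} T" if "T \<in> \<Theta>" for T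
      by (rule flat_dense_in[OF qf flat[OF that] assms[OF that]])
  qed
  then show ?thesis by simp
qed

text \<open>Independence in conductor form: x lies in \<open>T \<star> S\<close>, because that ring
  is all of K.\<close>

lemma dense_other:
  assumes "T \<in> \<Theta>" "S \<in> \<Theta>" "T \<noteq> S"
  shows "dense_in {c\<in>D. c * x \<in> T} S"
  using mem_localization_base_iff[OF qf flat[OF assms(2)] base_module[OF assms(1)], of x]
    independent[OF assms] by simp

text \<open>For \<open>T\<close> a Jaffard overring and \<open>b \<noteq> 0\<close> this is the statement \<open>1/b \<in> T (\<Inter>(\<Theta> - {T}))\<close>.\<close>
lemma jaffard_dense:
  assumes T: "T \<in> \<Theta>" "jaffard_overring D T" and b: "b \<in> D" "b \<noteq> 0"
  shows "dense_in {c\<in>D. \<forall>S\<in>\<Theta>-{T}. c / b \<in> S} T"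
proof -
  obtain \<Phi> where \<Phi>: "jaffard_family D \<Phi>" and T\<Phi>: "T \<in> \<Phi>"
    using T(2) unfolding jaffard_overring_def by blast
  interpret F: complete_family D \<Phi>
    using \<Phi> qf by unfold_locales (auto simp: jaffard_family_def)
  \<comment> \<open>The members of the auxiliary family, apart from \<open>T\<close>, in which b is
    not a unit. Local finiteness makes this set finite; in the remaining members other than
    \<open>T\<close>, c / b lies in the ring for every c in \<open>D\<close>.\<close>
  define E where "E = {S\<in>\<Phi>. inverse b \<notin> S} - {T}"
  have fin: "finite E"
    using \<Phi> b unfolding jaffard_family_def E_def by simp
  have "dense_in {c\<in>D. \<forall>S\<in>E. c * inverse b \<in> S} T"
  proof (rule dense_in_Ball[OF subring_base subring_mem[OF T(1)] base_subset[OF T(1)] fin])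
    fix S assume S: "S \<in> E"
    then have S': "S \<in> \<Phi>" "S \<noteq> T" by (auto simp: E_def)
    show "dense_in {c\<in>D. c * inverse b \<in> S} T"
      by (rule F.dense_other[OF S'(1) T\<Phi> S'(2)])
    show "c * d * inverse b \<in> S" if "c \<in> D" "d \<in> D" "c * inverse b \<in> S" for c d
      using that subring_ofD(5)[OF F.subring_mem[OF S'(1)], of "c * inverse b" d] F.base_subset[OF S'(1)]
      by (auto simp: mult_ac)
  qed
  \<comment> \<open>Transfer from \<Phi> to \<Theta>: c / b lies in all members of \<Phi> other than
    \<open>T\<close>, so d (c / b) lies in \<open>D\<close> whenever d / b is in \<open>T\<close>.
    Such d are dense in \<open>S\<close>, because \<open>T\<close> and \<open>S\<close> are
    independent in \<Theta>.\<close>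
  moreover have "{c\<in>D. \<forall>S\<in>E. c * inverse b \<in> S} \<subseteq> {c\<in>D. \<forall>S\<in>\<Theta>-{T}. c / b \<in> S}"
  proof (intro subsetI CollectI conjI ballI)
    fix c assume "c \<in> {c\<in>D. \<forall>S\<in>E. c * inverse b \<in> S}"
    then show "c \<in> D" by blast
  next
    fix c S assume "c \<in> {c\<in>D. \<forall>S\<in>E. c * inverse b \<in> S}" and "S \<in> \<Theta> - {T}"
    then have c: "c \<in> D" "\<forall>S\<in>E. c * inverse b \<in> S" and S: "S \<in> \<Theta>" "S \<noteq> T"
      by blast+
    have c': "c / b \<in> U" if "U \<in> \<Phi>" "U \<noteq> T" for U
    proof (cases "U \<in> E")
      case True
      then show ?thesis using c(2) by (simp add: divide_inverse)
    next
      case False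
      then have "inverse b \<in> U" using that by (simp add: E_def)
      then show ?thesis
        using subring_ofD(5)[OF F.subring_mem[OF that(1)], of c "inverse b"] c(1) F.base_subset[OF that(1)]
        by (auto simp: divide_inverse)
    qed
    have "d * (c / b) \<in> S" if d: "d \<in> D" "d * inverse b \<in> T" for d
    proof -
      have "d * (c / b) \<in> D"
      proof (rule F.mem_baseI)
        fix U assume U: "U \<in> \<Phi>"
        show "d * (c / b) \<in> U"
        proof (cases "U = T")
          case True
          then show ?thesis
            using subring_ofD(5)[OF F.subring_mem[OF U], of "d * inverse b" c] c(1) d(2) F.base_subset[OF U]
            by (auto simp: divide_inverse mult_ac)
        next
          case False
          then show ?thesis
            using subring_ofD(5)[OF F.subring_mem[OF U], of d "c / b"] c'[OF U] d(1) F.base_subset[OF U] by auto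
        qed
      qed
      then show ?thesis using base_subset[OF S(1)] by blast
    qed
    then have "{d\<in>D. d * inverse b \<in> T} \<subseteq> {d\<in>D. d * (c / b) \<in> S}"
      by blast
    then have "dense_in {d\<in>D. d * (c / b) \<in> S} S"
      using dense_other[OF T(1) S(1) S(2)[symmetric], of "inverse b"] dense_in_mono by blast
    then have "c / b \<in> S \<star> S"
      using mem_localization_base_iff[OF qf flat[OF S(1)] base_module[OF S(1)]] by blast
    then show "c / b \<in> S"
      by (simp add: set_prod_subring[OF subring_mem[OF S(1)]])
  qed
  ultimately show ?thesis
    by (rule dense_in_mono)
qed

end

subsection \<open>Families with a single non-Jaffard member\<close>

locale pointed_family = complete_family D \<Theta> for D :: "'a::field set" and \<Theta> +
  fixes Tinf :: "'a set"
  assumes Tinf_mem: "Tinf \<in> \<Theta>"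
    and jaffard_mem: "T \<in> \<Theta> \<Longrightarrow> T \<noteq> Tinf \<Longrightarrow> jaffard_overring D T"
begin

text \<open>A variant of Cohen's theorem: the elements of \<open>D\<close> that multiply some finite intersection of the
  ideals \<open>x T \<inter> D\<close> into \<open>I\<close> form an ideal, which is the unit ideal because it is so locally.\<close>
lemma finite_not_dense:
  assumes I: "ideal_of D I" and dense: "dense_in I Tinf"
  shows "finite {T\<in>\<Theta>. \<not> dense_in I T}"
proof -
  have "\<not> I \<subseteq> {0}"
  proof
    assume "I \<subseteq> {0}"
    then have "I \<star> Tinf \<subseteq> {0}"
      by (intro set_prod_subset) auto
    then show False using dense unfolding dense_in_def by auto
  qed
  then obtain x where x: "x \<in> I" "x \<noteq> 0" by blast
  have ID: "I \<subseteq> D" and I_add: "\<And>x y. x \<in> I \<Longrightarrow> y \<in> I \<Longrightarrow> x + y \<in> I"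
    and I0: "0 \<in> I" and I_mult: "\<And>r x. r \<in> D \<Longrightarrow> x \<in> I \<Longrightarrow> r * x \<in> I"
    using I unfolding ideal_of_def by auto
  define Q where "Q F = {d\<in>D. \<forall>T\<in>F. d * inverse x \<in> T}" for F
  define J where "J = {c\<in>D. \<exists>F. finite F \<and> F \<subseteq> \<Theta> - {Tinf} \<and> (\<forall>q\<in>Q F. c * q \<in> I)}"
  have "1 \<in> J"
  proof (rule pre_jaffard_one_mem[OF pj])
    show "ideal_of D J"
      unfolding ideal_of_def
    proof (intro conjI ballI)
      show "J \<subseteq> D" unfolding J_def by blast
      show "0 \<in> J"
        unfolding J_def using subring_ofD(1)[OF subring_base] I0
        by (intro CollectI conjI exI[of _ "{}"]) simp_all
      show "c + d \<in> J" if c: "c \<in> J" and d: "d \<in> J" for c d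
      proof -
        obtain F where F: "c \<in> D" "finite F" "F \<subseteq> \<Theta> - {Tinf}" "\<forall>q\<in>Q F. c * q \<in> I"
          using c unfolding J_def by blast
        obtain G where G: "d \<in> D" "finite G" "G \<subseteq> \<Theta> - {Tinf}" "\<forall>q\<in>Q G. d * q \<in> I"
          using d unfolding J_def by blast
        have "Q (F \<union> G) \<subseteq> Q F \<inter> Q G"
          unfolding Q_def by blast
        then have "\<forall>q\<in>Q (F \<union> G). (c + d) * q \<in> I"
          using F(4) G(4) I_add by (metis Int_iff distrib_right subsetD)
        then show ?thesis
          unfolding J_def using F(1-3) G(1-3) subring_ofD(3)[OF subring_base]
          by (intro CollectI conjI exI[of _ "F \<union> G"]) simp_all
      qed
      show "r * c \<in> J" if r: "r \<in> D" and c: "c \<in> J" for r c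
      proof -
        obtain F where F: "c \<in> D" "finite F" "F \<subseteq> \<Theta> - {Tinf}" "\<forall>q\<in>Q F. c * q \<in> I"
          using c unfolding J_def by blast
        then show ?thesis
          unfolding J_def using r subring_ofD(5)[OF subring_base] I_mult[OF r]
          by (intro CollectI conjI exI[of _ F]) (simp_all add: mult.assoc)
      qed
    qed
    show "dense_in J S" if S: "S \<in> \<Theta>" for S
    proof (cases "S = Tinf")
      case True
      \<comment> \<open>With no members selected, \<open>Q {}\<close> is all of \<open>D\<close>.
        Hence \<open>I\<close> lies in \<open>J\<close>, and \<open>I\<close> is dense in
        \<open>Tinf\<close> by hypothesis.\<close>
      have "c \<in> J" if c: "c \<in> I" for c
      proof -
        have "\<forall>q\<in>Q {}. c * q \<in> I"
          using I_mult[OF _ c] by (auto simp: Q_def mult.commute)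
        then show ?thesis
          unfolding J_def using c ID by (intro CollectI conjI exI[of _ "{}"]) auto
      qed
      then have "I \<subseteq> J" by blast
      with dense True show ?thesis
        using dense_in_mono by blast
    next
      case False
      \<comment> \<open>One selected member suffices here: at the members other than
        \<open>S\<close> the quotient c / x is used, at \<open>S\<close> the quotient q / x. So c q
        lies in x D, which is contained in \<open>I\<close>.\<close>
      have "{c\<in>D. \<forall>S'\<in>\<Theta>-{S}. c / x \<in> S'} \<subseteq> J"
      proof
        fix c assume "c \<in> {c\<in>D. \<forall>S'\<in>\<Theta>-{S}. c / x \<in> S'}"
        then have c: "c \<in> D" "\<And>S'. S' \<in> \<Theta> \<Longrightarrow> S' \<noteq> S \<Longrightarrow> c / x \<in> S'" by auto
        have "c * q \<in> I" if "q \<in> Q {S}" for q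
        proof -
          have q: "q \<in> D" "q * inverse x \<in> S" using that by (auto simp: Q_def)
          have "c * q / x \<in> D"
          proof (rule mem_baseI)
            fix U assume U: "U \<in> \<Theta>"
            note mult = subring_ofD(5)[OF subring_mem[OF U]]
            show "c * q / x \<in> U"
            proof (cases "U = S")
              case True
              then show ?thesis
                using mult[of c "q * inverse x"] c(1) q(2) base_subset[OF U] by (auto simp: divide_inverse mult_ac)
            next
              case False
              then show ?thesis
                using mult[of "c / x" q] c(2)[OF U] q(1) base_subset[OF U] by (auto simp: divide_inverse mult_ac)
            qed
          qed
          from I_mult[OF this x(1)] show ?thesis
            using x(2) by simp
        qed
        then show "c \<in> J"
          unfolding J_def using c(1) S False by (intro CollectI conjI exI[of _ "{S}"]) auto
      qed
      moreover have "dense_in {c\<in>D. \<forall>S'\<in>\<Theta>-{S}. c / x \<in> S'} S"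
        using jaffard_dense[OF S jaffard_mem[OF S False], of x] x ID by blast
      ultimately show ?thesis
        using dense_in_mono by blast
    qed
  qed
  then obtain F where F: "finite F" "F \<subseteq> \<Theta> - {Tinf}" "\<forall>q\<in>Q F. 1 * q \<in> I"
    unfolding J_def by blast
  \<comment> \<open>Since \<open>Q F\<close> is contained in \<open>I\<close>, it is enough that
    \<open>Q F\<close> is dense in \<open>S\<close>. For \<open>S\<close> outside \<open>F\<close>,
    independence settles each of the finitely many conditions defining \<open>Q F\<close>.\<close>
  have "dense_in I S" if S: "S \<in> \<Theta>" "S \<notin> F" for S
  proof -
    have "dense_in (Q F) S"
      unfolding Q_def
    proof (rule dense_in_Ball[OF subring_base subring_mem[OF S(1)] base_subset[OF S(1)] F(1)])
      fix T assume T: "T \<in> F"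
      then have T': "T \<in> \<Theta>" "T \<noteq> S" using F(2) S(2) by auto
      show "dense_in {c\<in>D. c * inverse x \<in> T} S"
        by (rule dense_other[OF T'(1) S(1) T'(2)])
      show "c * d * inverse x \<in> T" if "c \<in> D" "d \<in> D" "c * inverse x \<in> T" for c d
        using that subring_ofD(5)[OF subring_mem[OF T'(1)], of "c * inverse x" d] base_subset[OF T'(1)]
        by (auto simp: mult_ac)
    qed
    then show ?thesis
      by (rule dense_in_mono) (use F(3) in auto)
  qed
  then have "{T\<in>\<Theta>. \<not> dense_in I T} \<subseteq> F" by blast
  then show ?thesis
    using F(1) finite_subset by blast
qed

end

subsection \<open>Gluing local data\<close>

locale embedded_family = field_embedding \<sigma> + pointed_family D \<Theta> Tinf
  for \<sigma> :: "'a::field \<Rightarrow> 'b::field" and D :: "'a set" and \<Theta> and Tinf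
begin

lemma subring_image: "T \<in> \<Theta> \<Longrightarrow> subring_of (\<sigma> ` T)"
  by (rule subring_of_image[OF subring_mem])

lemma subring_image_base: "subring_of (\<sigma> ` D)"
  by (rule subring_of_image[OF subring_base])

lemma image_idem: "T \<in> \<Theta> \<Longrightarrow> \<sigma> ` T \<star> \<sigma> ` T = \<sigma> ` T"
  by (rule set_prod_subring[OF subring_image])

lemma image_UNIV: "T \<in> \<Theta> \<Longrightarrow> \<sigma> ` T \<star> \<sigma> ` UNIV = \<sigma> ` UNIV"
proof -
  assume T: "T \<in> \<Theta>"
  have "T \<star> UNIV = UNIV"
    using set_prod_unit_superset[OF subring_ofD(2)[OF subring_mem[OF T]], of UNIV]
    by (auto simp: set_prod_commute)
  then show ?thesis
    by (simp flip: image_set_prod)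
qed

lemma image_base: "T \<in> \<Theta> \<Longrightarrow> \<sigma> ` D \<star> \<sigma> ` T = \<sigma> ` T"
  using base_module[of T] by (simp flip: image_set_prod)

lemma subset_localization: "T \<in> \<Theta> \<Longrightarrow> M \<subseteq> M \<star> \<sigma> ` T"
  by (rule set_prod_unit_superset[OF subring_ofD(2)[OF subring_image]])

lemma subset_localization_UNIV: "M \<subseteq> M \<star> \<sigma> ` UNIV"
  by (rule set_prod_unit_superset) (use emb_one in \<open>metis rangeI\<close>)

lemma localization_mult:
  "T \<in> \<Theta> \<Longrightarrow> (I \<star> J) \<star> \<sigma> ` T = (I \<star> \<sigma> ` T) \<star> (J \<star> \<sigma> ` T)"
proof -
  assume T: "T \<in> \<Theta>"
  have "(I \<star> \<sigma> ` T) \<star> (J \<star> \<sigma> ` T) = (I \<star> J) \<star> (\<sigma> ` T \<star> \<sigma> ` T)"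
    by (simp add: set_prod_ac)
  then show ?thesis
    by (simp add: image_idem[OF T])
qed

lemma localization_localization:
  "T \<in> \<Theta> \<Longrightarrow> (M \<star> \<sigma> ` T) \<star> \<sigma> ` T = M \<star> \<sigma> ` T"
  by (simp add: set_prod_assoc image_idem)

lemma localization_UNIV:
  "T \<in> \<Theta> \<Longrightarrow> (M \<star> \<sigma> ` T) \<star> \<sigma> ` UNIV = M \<star> \<sigma> ` UNIV"
  by (simp add: set_prod_assoc image_UNIV)

lemma base_module_of_module:
  assumes "T \<in> \<Theta>" "\<sigma> ` T \<star> N = N"
  shows "\<sigma> ` D \<star> N = N"
proof -
  have "\<sigma> ` D \<star> (\<sigma> ` T \<star> N) = \<sigma> ` T \<star> N"
    unfolding set_prod_assoc[symmetric] image_base[OF assms(1)] ..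
  then show ?thesis
    by (simp add: assms(2))
qed

lemma module_closed:
  assumes "\<sigma> ` D \<star> M = M"
  shows "0 \<in> M" and "x \<in> M \<Longrightarrow> y \<in> M \<Longrightarrow> x + y \<in> M" and "c \<in> D \<Longrightarrow> x \<in> M \<Longrightarrow> \<sigma> c * x \<in> M"
  using set_prod_zero[of "\<sigma> ` D" M] set_prod_add[of x "\<sigma> ` D" M y] set_prod_mult[of "\<sigma> c" "\<sigma> ` D" x M]
  unfolding assms by auto

lemma ideal_of_colon:
  assumes M: "\<sigma> ` D \<star> M = M"
  shows "ideal_of D (colon D M y)"
  unfolding ideal_of_def colon_def
proof (intro conjI ballI)
  show "0 \<in> {c\<in>D. \<sigma> c * y \<in> M}"
    using subring_ofD(1)[OF subring_base] module_closed(1)[OF M] by simp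
  show "a + b \<in> {c\<in>D. \<sigma> c * y \<in> M}" if "a \<in> {c\<in>D. \<sigma> c * y \<in> M}" "b \<in> {c\<in>D. \<sigma> c * y \<in> M}" for a b
    using that subring_ofD(3)[OF subring_base] module_closed(2)[OF M] by (simp add: emb_add distrib_right)
  show "r * a \<in> {c\<in>D. \<sigma> c * y \<in> M}" if "r \<in> D" "a \<in> {c\<in>D. \<sigma> c * y \<in> M}" for r a
    using that subring_ofD(5)[OF subring_base] module_closed(3)[OF M] by (simp add: emb_mult mult.assoc)
qed blast

text \<open>For y in \<open>M\<close>, the conductor of y into \<open>N\<close> is an ideal of
  \<open>D\<close> that is dense in every member of the family.\<close>

lemma local_subset:
  assumes M: "\<sigma> ` D \<star> M = M" and N: "\<sigma> ` D \<star> N = N"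
    and loc: "\<And>T. T \<in> \<Theta> \<Longrightarrow> M \<star> \<sigma> ` T \<subseteq> N \<star> \<sigma> ` T"
  shows "M \<subseteq> N"
proof
  fix y assume y: "y \<in> M"
  have "1 \<in> colon D N y"
  proof (rule pre_jaffard_one_mem[OF pj ideal_of_colon[OF N]])
    fix T assume T: "T \<in> \<Theta>"
    have "y \<in> N \<star> \<sigma> ` T"
      using y subset_localization[OF T, of M] loc[OF T] by blast
    then show "dense_in (colon D N y) T"
      using mem_localization_iff[OF qf flat[OF T] N] by blast
  qed
  then show "y \<in> N"
    by (simp add: colon_def)
qed

lemma local_eq:
  assumes "\<sigma> ` D \<star> M = M" "\<sigma> ` D \<star> N = N" "\<And>T. T \<in> \<Theta> \<Longrightarrow> M \<star> \<sigma> ` T = N \<star> \<sigma> ` T"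
  shows "M = N"
  using local_subset[of M N] local_subset[of N M] assms by simp

lemma clear_denominator:
  assumes M: "\<sigma> ` D \<star> M = M" and y: "y \<in> M \<star> \<sigma> ` UNIV"
  obtains b where "b \<in> D" "b \<noteq> 0" "\<sigma> b * y \<in> M"
proof -
  have "\<exists>b\<in>D. b \<noteq> 0 \<and> \<sigma> b * y \<in> M"
    using y
  proof (induction rule: set_prod_induct)
    case zero
    show ?case
      using subring_ofD(2)[OF subring_base] module_closed(1)[OF M] by (intro bexI[of _ 1]) auto
  next
    case (add x y)
    then obtain b c where b: "b \<in> D" "b \<noteq> 0" "\<sigma> b * x \<in> M" and c: "c \<in> D" "c \<noteq> 0" "\<sigma> c * y \<in> M"
      by blast
    have "\<sigma> c * (\<sigma> b * x) + \<sigma> b * (\<sigma> c * y) \<in> M"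
      by (rule module_closed(2)[OF M module_closed(3)[OF M c(1) b(3)] module_closed(3)[OF M b(1) c(3)]])
    then have "\<sigma> (b * c) * (x + y) \<in> M"
      by (simp add: emb_mult distrib_left mult_ac)
    then show ?case
      using b c subring_ofD(5)[OF subring_base] by (intro bexI[of _ "b * c"]) auto
  next
    case (mult m k)
    then obtain t where t: "k = \<sigma> t" by blast
    obtain a b where ab: "a \<in> D" "b \<in> D" "b \<noteq> 0" "t = a / b"
      using qf unfolding domain_with_qf_def by blast
    have "\<sigma> b * (m * k) = \<sigma> (b * t) * m"
      by (simp add: t emb_mult mult_ac)
    also have "b * t = a"
      using ab by simp
    finally have "\<sigma> b * (m * k) \<in> M"
      using module_closed(3)[OF M ab(1) mult(1)] by (simp only:)
    then show ?case using ab by blast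
  qed
  then show ?thesis using that by blast
qed

text \<open>The point is that localizing at \<open>S\<close> commutes with this possibly infinite
  intersection. For y in \<open>N S\<close> one needs a dense set of c in \<open>D\<close> moving y
  into every \<open>N T\<close> at once. The finitely many T in \<open>E\<close> are handled by
  independence, the others all together through \<open>M\<close>.\<close>

lemma glue:
  assumes E: "finite E" "E \<subseteq> \<Theta> - {Tinf}"
    and M: "\<sigma> ` D \<star> M = M"
    and N: "\<And>T. T \<in> \<Theta> \<Longrightarrow> \<sigma> ` T \<star> N T = N T"
    and N_UNIV: "\<And>T. T \<in> \<Theta> \<Longrightarrow> N T \<star> \<sigma> ` UNIV = M \<star> \<sigma> ` UNIV"
    and N_M: "\<And>T. T \<in> \<Theta> - E \<Longrightarrow> N T = M \<star> \<sigma> ` T"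
  shows "\<sigma> ` D \<star> (\<Inter>T\<in>\<Theta>. N T) = (\<Inter>T\<in>\<Theta>. N T)"
    and "S \<in> \<Theta> \<Longrightarrow> (\<Inter>T\<in>\<Theta>. N T) \<star> \<sigma> ` S = N S"
proof -
  let ?I = "\<Inter>T\<in>\<Theta>. N T"
  have DN: "\<sigma> ` D \<star> N T = N T" if "T \<in> \<Theta>" for T
    by (rule base_module_of_module[OF that N[OF that]])
  have Dmult: "\<sigma> (c * d) * y \<in> N T" if "T \<in> \<Theta>" "d \<in> D" "\<sigma> c * y \<in> N T" for c d y T
    using module_closed(3)[OF DN[OF that(1)] that(2,3)] by (simp add: emb_mult mult_ac)
  have "submodule_of (\<sigma> ` D) ?I"
    unfolding submodule_of_def
  proof (intro conjI ballI INT_I)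
    show "0 \<in> N T" if "T \<in> \<Theta>" for T
      using module_closed(1)[OF DN[OF that]] .
    show "x + y \<in> N T" if "x \<in> ?I" "y \<in> ?I" "T \<in> \<Theta>" for x y T
      using module_closed(2)[OF DN[OF that(3)]] that by blast
    show "c * x \<in> N T" if "c \<in> \<sigma> ` D" "x \<in> ?I" "T \<in> \<Theta>" for c x T
      using module_closed(3)[OF DN[OF that(3)]] that by blast
  qed
  then show DI: "\<sigma> ` D \<star> ?I = ?I"
    using set_prod_eq_submodule[OF subring_ofD(2)[OF subring_image_base]] by blast
  assume S: "S \<in> \<Theta>"
  show "?I \<star> \<sigma> ` S = N S"
  proof
    have "?I \<star> \<sigma> ` S \<subseteq> N S \<star> \<sigma> ` S"
      using S by (intro set_prod_mono) auto
    then show "?I \<star> \<sigma> ` S \<subseteq> N S"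
      using N[OF S] by (simp add: set_prod_commute)
  next
    show "N S \<subseteq> ?I \<star> \<sigma> ` S"
    proof
      fix y assume y: "y \<in> N S"
      have yV: "y \<in> M \<star> \<sigma> ` UNIV"
        using y subset_localization_UNIV[of "N S"] N_UNIV[OF S] by blast
      have other: "dense_in {c\<in>D. \<sigma> c * y \<in> N T} S" if T: "T \<in> \<Theta>" "T \<noteq> S" for T
      proof -
        \<comment> \<open>Here \<open>T \<star> S\<close> is all of K, so localizing the T-module
          \<open>N T\<close> at \<open>S\<close> already gives its generic fibre, which contains
          y.\<close>
        have "N T \<star> \<sigma> ` UNIV = (\<sigma> ` T \<star> N T) \<star> \<sigma> ` S"
          using independent[OF T(1) S T(2)] by (simp flip: image_set_prod add: set_prod_ac)
        then have "y \<in> N T \<star> \<sigma> ` S"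
          using yV N[OF T(1)] N_UNIV[OF T(1)] by simp
        then show ?thesis
          using mem_localization_iff[OF qf flat[OF S] DN[OF T(1)]] by (simp add: colon_def)
      qed
      have 1: "dense_in {c\<in>D. \<forall>T\<in>E-{S}. \<sigma> c * y \<in> N T} S"
        by (rule dense_in_Ball[OF subring_base subring_mem[OF S] base_subset[OF S]])
           (use E other Dmult in auto)
      \<comment> \<open>If \<open>S\<close> is not in \<open>E\<close>, then y lies in the
        localization of \<open>M\<close> at \<open>S\<close>, and the conductor of y into
        \<open>M\<close> serves every T outside \<open>E\<close>. If \<open>S\<close> is in
        \<open>E\<close>, only the generic fibre of \<open>M\<close> is known to contain y; a
        denominator b is then confined to the Jaffard overring \<open>S\<close>.\<close>
      have 2: "dense_in {c\<in>D. \<forall>T\<in>\<Theta>-E-{S}. \<sigma> c * y \<in> N T} S"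
      proof (cases "S \<in> E")
        case False
        then have "y \<in> M \<star> \<sigma> ` S"
          using y N_M S by blast
        then have "dense_in (colon D M y) S"
          using mem_localization_iff[OF qf flat[OF S] M] by blast
        then show ?thesis
        proof (rule dense_in_mono)
          show "colon D M y \<subseteq> {c\<in>D. \<forall>T\<in>\<Theta>-E-{S}. \<sigma> c * y \<in> N T}"
            using subset_localization[of _ M] N_M unfolding colon_def by blast
        qed
      next
        case True
        obtain b where b: "b \<in> D" "b \<noteq> 0" "\<sigma> b * y \<in> M"
          using clear_denominator[OF M yV] by blast
        have "S \<noteq> Tinf" using True E by blast
        then have "dense_in {c\<in>D. \<forall>T\<in>\<Theta>-{S}. c / b \<in> T} S"
          using jaffard_dense[OF S jaffard_mem[OF S] b(1,2)] by blast
        then show ?thesis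
        proof (rule dense_in_mono; intro subsetI CollectI conjI ballI)
          fix c T assume c: "c \<in> {c\<in>D. \<forall>T\<in>\<Theta>-{S}. c / b \<in> T}" and T: "T \<in> \<Theta> - E - {S}"
          have "(\<sigma> b * y) * \<sigma> (c / b) \<in> M \<star> \<sigma> ` T"
            using b(3) c T by (intro set_prod_mult) auto
          also have "(\<sigma> b * y) * \<sigma> (c / b) = \<sigma> (b * (c / b)) * y"
            by (simp only: emb_mult mult_ac)
          also have "b * (c / b) = c"
            using b(2) by simp
          finally show "\<sigma> c * y \<in> N T"
            using N_M T by blast
        qed blast
      qed
      have "dense_in {c\<in>D. (\<forall>T\<in>E-{S}. \<sigma> c * y \<in> N T) \<and> (\<forall>T\<in>\<Theta>-E-{S}. \<sigma> c * y \<in> N T)} S"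
        by (rule dense_in_Int[OF subring_base subring_mem[OF S] 1 2]) (use E Dmult in blast)+
      then have "dense_in (colon D ?I y) S"
        by (rule dense_in_mono)
           (use module_closed(3)[OF DN[OF S] _ y] in \<open>auto simp: colon_def\<close>)
      then show "y \<in> ?I \<star> \<sigma> ` S"
        using mem_localization_iff[OF qf flat[OF S] DI] by blast
    qed
  qed
qed

end

section \<open>Invertible ideals over a ring containing the image of D, and their
  localizations\<close>

locale embedded_ring = embedded_family \<sigma> D \<Theta> Tinf
  for \<sigma> :: "'a::field \<Rightarrow> 'b::field" and D :: "'a set" and \<Theta> and Tinf +
  fixes R :: "'b set"
  assumes subring_R: "subring_of R" and image_subset_R: "\<sigma> ` D \<subseteq> R"
begin

lemma subring_localization: "T \<in> \<Theta> \<Longrightarrow> subring_of (R \<star> \<sigma> ` T)"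
  by (rule subring_of_set_prod[OF subring_R subring_image])

lemma R_idem: "R \<star> R = R"
  by (rule set_prod_subring[OF subring_R])

lemma image_base_R: "\<sigma> ` D \<star> R = R"
  by (rule overring_module[OF subring_image_base subring_R image_subset_R])

lemma base_module_of_R_module:
  assumes "R \<star> M = M"
  shows "\<sigma> ` D \<star> M = M"
proof -
  have "\<sigma> ` D \<star> (R \<star> M) = R \<star> M"
    unfolding set_prod_assoc[symmetric] image_base_R ..
  then show ?thesis
    by (simp add: assms)
qed

lemma localization_idem: "T \<in> \<Theta> \<Longrightarrow> (R \<star> \<sigma> ` T) \<star> (R \<star> \<sigma> ` T) = R \<star> \<sigma> ` T"
  by (rule set_prod_subring[OF subring_localization])

lemma localization_inverse_pair:
  assumes T: "T \<in> \<Theta>" and IJ: "inverse_pair R I J"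
  shows "inverse_pair (R \<star> \<sigma> ` T) (I \<star> \<sigma> ` T) (J \<star> \<sigma> ` T)"
  using IJ unfolding inverse_pair_def by (simp flip: localization_mult[OF T])

text \<open>The ideals and their inverses are glued separately; that the two intersections are
  inverse to each other is then a local question.\<close>

lemma glue_inverse_pair:
  assumes E: "finite E" "E \<subseteq> \<Theta> - {Tinf}"
    and M: "\<sigma> ` D \<star> M = M" "\<sigma> ` D \<star> M' = M'"
    and N: "\<And>T. T \<in> \<Theta> \<Longrightarrow> inverse_pair (R \<star> \<sigma> ` T) (N T) (N' T)"
    and N_UNIV: "\<And>T. T \<in> \<Theta> \<Longrightarrow> N T \<star> \<sigma> ` UNIV = M \<star> \<sigma> ` UNIV"
      "\<And>T. T \<in> \<Theta> \<Longrightarrow> N' T \<star> \<sigma> ` UNIV = M' \<star> \<sigma> ` UNIV"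
    and N_M: "\<And>T. T \<in> \<Theta> - E \<Longrightarrow> N T = M \<star> \<sigma> ` T" "\<And>T. T \<in> \<Theta> - E \<Longrightarrow> N' T = M' \<star> \<sigma> ` T"
  obtains I J where "inverse_pair R I J" "\<And>T. T \<in> \<Theta> \<Longrightarrow> I \<star> \<sigma> ` T = N T" "\<And>T. T \<in> \<Theta> \<Longrightarrow> J \<star> \<sigma> ` T = N' T"
proof -
  have T_module: "\<sigma> ` T \<star> X = X" if "T \<in> \<Theta>" "(R \<star> \<sigma> ` T) \<star> X = X" for T X
  proof -
    have "\<sigma> ` T \<star> ((R \<star> \<sigma> ` T) \<star> X) = (R \<star> (\<sigma> ` T \<star> \<sigma> ` T)) \<star> X"
      by (simp add: set_prod_ac)
    then show ?thesis
      by (simp add: image_idem[OF that(1)] that(2))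
  qed
  have R_module: "R \<star> X = X" if "T \<in> \<Theta>" "(R \<star> \<sigma> ` T) \<star> X = X" for T X
  proof -
    have "R \<star> ((R \<star> \<sigma> ` T) \<star> X) = ((R \<star> R) \<star> \<sigma> ` T) \<star> X"
      by (simp add: set_prod_ac)
    then show ?thesis
      by (simp add: R_idem that(2))
  qed
  have inter_module: "R \<star> (\<Inter>T\<in>\<Theta>. X T) = (\<Inter>T\<in>\<Theta>. X T)" if "\<And>T. T \<in> \<Theta> \<Longrightarrow> R \<star> X T = X T" for X
  proof
    show "R \<star> (\<Inter>T\<in>\<Theta>. X T) \<subseteq> (\<Inter>T\<in>\<Theta>. X T)"
    proof (rule INT_greatest)
      fix T assume T: "T \<in> \<Theta>"
      have "R \<star> (\<Inter>T\<in>\<Theta>. X T) \<subseteq> R \<star> X T"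
        using T by (intro set_prod_mono) auto
      then show "R \<star> (\<Inter>T\<in>\<Theta>. X T) \<subseteq> X T"
        using that[OF T] by simp
    qed
    show "(\<Inter>T\<in>\<Theta>. X T) \<subseteq> R \<star> (\<Inter>T\<in>\<Theta>. X T)"
      unfolding set_prod_commute[of R] by (rule set_prod_unit_superset[OF subring_ofD(2)[OF subring_R]])
  qed
  have N1: "(R \<star> \<sigma> ` T) \<star> N T = N T" and N2: "(R \<star> \<sigma> ` T) \<star> N' T = N' T"
    and N12: "N T \<star> N' T = R \<star> \<sigma> ` T" if "T \<in> \<Theta>" for T
    using N[OF that] by (auto simp: inverse_pair_def)
  let ?I = "\<Inter>T\<in>\<Theta>. N T" and ?J = "\<Inter>T\<in>\<Theta>. N' T"
  have I: "?I \<star> \<sigma> ` T = N T" if "T \<in> \<Theta>" for T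
    by (rule glue(2)[OF E M(1) T_module[OF _ N1] N_UNIV(1) N_M(1) that])
  have J: "?J \<star> \<sigma> ` T = N' T" if "T \<in> \<Theta>" for T
    by (rule glue(2)[OF E M(2) T_module[OF _ N2] N_UNIV(2) N_M(2) that])
  have RI: "R \<star> ?I = ?I"
    by (rule inter_module[OF R_module[OF _ N1]])
  have RJ: "R \<star> ?J = ?J"
    by (rule inter_module[OF R_module[OF _ N2]])
  have "?I \<star> ?J = R"
  proof (rule local_eq)
    show "\<sigma> ` D \<star> (?I \<star> ?J) = ?I \<star> ?J"
      unfolding set_prod_assoc[symmetric] base_module_of_R_module[OF RI] ..
    show "(?I \<star> ?J) \<star> \<sigma> ` T = R \<star> \<sigma> ` T" if "T \<in> \<Theta>" for T
      unfolding localization_mult[OF that] I[OF that] J[OF that] by (rule N12[OF that])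
  qed (rule image_base_R)
  then show ?thesis
    using that[of ?I ?J] RI RJ I J unfolding inverse_pair_def by blast
qed

text \<open>The common conductor of \<open>F\<close> into \<open>R\<close> is an ideal of
  \<open>D\<close> that is dense in \<open>Tinf\<close>. By \<open>finite_not_dense\<close> it is
  dense in all but finitely many members, and density in T puts \<open>F\<close> into the
  localization at T.\<close>

lemma finite_localization:
  assumes fin: "finite F" and F: "F \<subseteq> R \<star> \<sigma> ` Tinf"
  obtains E where "finite E" "E \<subseteq> \<Theta> - {Tinf}" "\<And>T. T \<in> \<Theta> - E \<Longrightarrow> F \<subseteq> R \<star> \<sigma> ` T"
proof -
  have mem_iff: "y \<in> R \<star> \<sigma> ` T \<longleftrightarrow> dense_in {c\<in>D. \<sigma> c * y \<in> R} T" if "T \<in> \<Theta>" for y T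
    using mem_localization_iff[OF qf flat[OF that] image_base_R] by (simp add: colon_def)
  let ?I = "{c\<in>D. \<forall>y\<in>F. \<sigma> c * y \<in> R}"
  have colon_mult: "\<sigma> (c * d) * y \<in> R" if "d \<in> D" "\<sigma> c * y \<in> R" for c d y
    using module_closed(3)[OF image_base_R that] by (simp add: emb_mult mult_ac)
  have dense: "dense_in ?I Tinf"
    by (rule dense_in_Ball[OF subring_base subring_mem[OF Tinf_mem] base_subset[OF Tinf_mem] fin])
       (use F mem_iff[OF Tinf_mem] colon_mult in blast)+
  have ideal: "ideal_of D ?I"
    unfolding ideal_of_def
  proof (intro conjI ballI)
    show "0 \<in> ?I"
      using subring_ofD(1)[OF subring_base] subring_ofD(1)[OF subring_R] by simp
    show "a + b \<in> ?I" if "a \<in> ?I" "b \<in> ?I" for a b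
      using that subring_ofD(3)[OF subring_base] subring_ofD(3)[OF subring_R]
      by (simp add: emb_add distrib_right)
    show "r * a \<in> ?I" if "r \<in> D" "a \<in> ?I" for r a
      using that subring_ofD(5)[OF subring_base] colon_mult[OF that(1)] by (simp add: mult.commute[of r])
  qed blast
  let ?E = "{T\<in>\<Theta>. \<not> dense_in ?I T}"
  show ?thesis
  proof (rule that[of ?E])
    show "finite ?E"
      by (rule finite_not_dense[OF ideal dense])
    show "?E \<subseteq> \<Theta> - {Tinf}"
      using dense by blast
    show "F \<subseteq> R \<star> \<sigma> ` T" if T: "T \<in> \<Theta> - ?E" for T
    proof
      fix y assume y: "y \<in> F"
      have "dense_in ?I T" "T \<in> \<Theta>" using T by blast+
      then show "y \<in> R \<star> \<sigma> ` T"
        using y mem_iff dense_in_mono[of ?I T "{c\<in>D. \<sigma> c * y \<in> R}"] by blast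
    qed
  qed
qed

text \<open>Generators of \<open>J\<close> and \<open>J'\<close> span \<open>R\<close>-modules
  \<open>M\<close> and \<open>M'\<close> that localize to \<open>J\<close> and \<open>J'\<close> at
  \<open>Tinf\<close>. They are inverse to each other at every member where all products of
  generators lie in the localization of \<open>R\<close>. At the finitely many remaining members
  they are replaced by the trivial ideal, which the hypothesis on generic fibres makes compatible
  with gluing.\<close>

lemma lift_inverse_pair:
  assumes JJ': "inverse_pair (R \<star> \<sigma> ` Tinf) J J'"
    and UN: "J \<star> \<sigma> ` UNIV = R \<star> \<sigma> ` UNIV" "J' \<star> \<sigma> ` UNIV = R \<star> \<sigma> ` UNIV"
  obtains I I' where "inverse_pair R I I'" "I \<star> \<sigma> ` Tinf = J" "I' \<star> \<sigma> ` Tinf = J'"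
proof -
  obtain n :: nat and f g where fg: "\<And>i. i < n \<Longrightarrow> f i \<in> J" "\<And>i. i < n \<Longrightarrow> g i \<in> J'" "(\<Sum>i<n. f i * g i) = 1"
    using inverse_pair_finite_sum[OF subring_localization[OF Tinf_mem] JJ'] by blast
  define A where "A = f ` {..<n}"
  define B where "B = g ` {..<n}"
  have J: "(R \<star> \<sigma> ` Tinf) \<star> J = J" and J': "(R \<star> \<sigma> ` Tinf) \<star> J' = J'" and prod: "J \<star> J' = R \<star> \<sigma> ` Tinf"
    using JJ' by (auto simp: inverse_pair_def)
  have AJ: "A \<subseteq> J" and BJ': "B \<subseteq> J'"
    using fg by (auto simp: A_def B_def)
  have "(\<Sum>i<n. f i * g i) \<in> A \<star> B"
    unfolding set_prod_def A_def B_def by (intro CollectI exI[of _ n] exI[of _ f] exI[of _ g]) auto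
  then have one: "1 \<in> A \<star> B"
    using fg(3) by simp
  \<comment> \<open>All products a b are taken, not only the f i g i of the sum, since
    \<open>A \<star> B\<close> has to lie inside the localization of \<open>R\<close>.\<close>
  define F where "F = (\<lambda>(a, b). a * b) ` (A \<times> B)"
  have finF: "finite F"
    unfolding F_def A_def B_def by auto
  have "F \<subseteq> J \<star> J'"
    unfolding F_def using AJ BJ' set_prod_mult[of _ J _ J'] by auto
  then have FR: "F \<subseteq> R \<star> \<sigma> ` Tinf"
    unfolding prod .
  obtain E where E: "finite E" "E \<subseteq> \<Theta> - {Tinf}" "\<And>T. T \<in> \<Theta> - E \<Longrightarrow> F \<subseteq> R \<star> \<sigma> ` T"
    using finite_localization[OF finF FR] by blast
  define M where "M = R \<star> A"
  define M' where "M' = R \<star> B"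
  have RM: "R \<star> M = M" "R \<star> M' = M'"
    by (simp_all add: M_def M'_def R_idem flip: set_prod_assoc)
  have MJ: "M \<star> \<sigma> ` Tinf = J"
  proof
    have "M \<star> \<sigma> ` Tinf = (R \<star> \<sigma> ` Tinf) \<star> A"
      by (simp add: M_def set_prod_ac)
    also have "\<dots> \<subseteq> (R \<star> \<sigma> ` Tinf) \<star> J"
      using AJ by (intro set_prod_mono) auto
    finally show "M \<star> \<sigma> ` Tinf \<subseteq> J" by (simp add: J)
    \<comment> \<open>Inserting the expression of 1 shows that \<open>A\<close> generates:
      multiplying \<open>J\<close> by \<open>B\<close> stays in \<open>J \<star> J'\<close>, which
      is the localized ring.\<close>
    have "J \<subseteq> J \<star> (A \<star> B)"
      by (rule set_prod_unit_superset[OF one])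
    also have "\<dots> = (J \<star> B) \<star> A"
      by (simp add: set_prod_ac)
    also have "\<dots> \<subseteq> (J \<star> J') \<star> A"
      using BJ' by (intro set_prod_mono) auto
    also have "\<dots> = M \<star> \<sigma> ` Tinf"
      by (simp add: prod M_def set_prod_ac)
    finally show "J \<subseteq> M \<star> \<sigma> ` Tinf" .
  qed
  have MJ': "M' \<star> \<sigma> ` Tinf = J'"
  proof
    have "M' \<star> \<sigma> ` Tinf = (R \<star> \<sigma> ` Tinf) \<star> B"
      by (simp add: M'_def set_prod_ac)
    also have "\<dots> \<subseteq> (R \<star> \<sigma> ` Tinf) \<star> J'"
      using BJ' by (intro set_prod_mono) auto
    finally show "M' \<star> \<sigma> ` Tinf \<subseteq> J'" by (simp add: J')
    have "J' \<subseteq> J' \<star> (A \<star> B)"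
      by (rule set_prod_unit_superset[OF one])
    also have "\<dots> = (A \<star> J') \<star> B"
      by (simp add: set_prod_ac)
    also have "\<dots> \<subseteq> (J \<star> J') \<star> B"
      using AJ by (intro set_prod_mono) auto
    also have "\<dots> = M' \<star> \<sigma> ` Tinf"
      by (simp add: prod M'_def set_prod_ac)
    finally show "J' \<subseteq> M' \<star> \<sigma> ` Tinf" .
  qed
  have M_UNIV: "M \<star> \<sigma> ` UNIV = R \<star> \<sigma> ` UNIV" "M' \<star> \<sigma> ` UNIV = R \<star> \<sigma> ` UNIV"
    using localization_UNIV[OF Tinf_mem, of M] localization_UNIV[OF Tinf_mem, of M'] UN by (simp_all add: MJ MJ')
  let ?N = "\<lambda>T. if T \<in> E then R \<star> \<sigma> ` T else M \<star> \<sigma> ` T"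
  let ?N' = "\<lambda>T. if T \<in> E then R \<star> \<sigma> ` T else M' \<star> \<sigma> ` T"
  have N: "inverse_pair (R \<star> \<sigma> ` T) (?N T) (?N' T)" if T: "T \<in> \<Theta>" for T
  proof (cases "T \<in> E")
    case True
    then show ?thesis
      by (simp add: inverse_pair_def localization_idem[OF T])
  next
    case False
    note sR = subring_ofD[OF subring_localization[OF T]]
    have AB: "A \<star> B \<subseteq> R \<star> \<sigma> ` T"
      using E(3)[of T] T False sR(1,3) by (intro set_prod_subset) (auto simp: F_def)
    have eq: "(M \<star> M') \<star> \<sigma> ` T = (R \<star> \<sigma> ` T) \<star> (A \<star> B)"
    proof -
      have "(M \<star> M') \<star> \<sigma> ` T = ((R \<star> R) \<star> \<sigma> ` T) \<star> (A \<star> B)"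
        by (simp add: M_def M'_def set_prod_ac)
      then show ?thesis by (simp add: R_idem)
    qed
    have "(M \<star> M') \<star> \<sigma> ` T = R \<star> \<sigma> ` T"
    proof
      show "(M \<star> M') \<star> \<sigma> ` T \<subseteq> R \<star> \<sigma> ` T"
        unfolding eq using set_prod_mono[OF subset_refl AB, of "R \<star> \<sigma> ` T"] by (simp add: localization_idem[OF T])
      show "R \<star> \<sigma> ` T \<subseteq> (M \<star> M') \<star> \<sigma> ` T"
        unfolding eq by (rule set_prod_unit_superset[OF one])
    qed
    then show ?thesis
      using False by (simp add: inverse_pair_def RM flip: localization_mult[OF T])
  qed
  obtain I I' where I: "inverse_pair R I I'" "\<And>T. T \<in> \<Theta> \<Longrightarrow> I \<star> \<sigma> ` T = ?N T" "\<And>T. T \<in> \<Theta> \<Longrightarrow> I' \<star> \<sigma> ` T = ?N' T"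
  proof (rule glue_inverse_pair[OF E(1,2) base_module_of_R_module[OF RM(1)] base_module_of_R_module[OF RM(2)] N])
    show "?N T \<star> \<sigma> ` UNIV = M \<star> \<sigma> ` UNIV" "?N' T \<star> \<sigma> ` UNIV = M' \<star> \<sigma> ` UNIV" if "T \<in> \<Theta>" for T
      by (simp_all add: localization_UNIV[OF that] M_UNIV)
  qed auto
  have "Tinf \<notin> E" using E(2) by blast
  then show ?thesis
    using that[OF I(1)] I(2,3)[OF Tinf_mem] MJ MJ' by simp
qed

text \<open>\<open>J\<close> is trivial at \<open>Tinf\<close> as well, so generators of both ideals
  lie in the localization of \<open>R\<close> at almost every member. There both localized ideals
  are contained in the localized ring, and being inverse to each other they must equal it. This
  gives families of local classes their finite support.\<close>

lemma finite_nontrivial: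
  assumes IJ: "inverse_pair R I J" and Iinf: "I \<star> \<sigma> ` Tinf = R \<star> \<sigma> ` Tinf"
  shows "finite {T\<in>\<Theta>. I \<star> \<sigma> ` T \<noteq> R \<star> \<sigma> ` T}"
proof -
  obtain n :: nat and f g where fg: "\<And>i. i < n \<Longrightarrow> f i \<in> I" "\<And>i. i < n \<Longrightarrow> g i \<in> J" "(\<Sum>i<n. f i * g i) = 1"
    using inverse_pair_finite_sum[OF subring_R IJ] by blast
  define A where "A = f ` {..<n}"
  define B where "B = g ` {..<n}"
  have AI: "A \<subseteq> I" and BJ: "B \<subseteq> J"
    using fg by (auto simp: A_def B_def)
  have "(\<Sum>i<n. f i * g i) \<in> A \<star> B"
    unfolding set_prod_def A_def B_def by (intro CollectI exI[of _ n] exI[of _ f] exI[of _ g]) auto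
  then have one: "1 \<in> A \<star> B"
    using fg(3) by simp
  have RI: "R \<star> I = I" and RJ: "R \<star> J = J" and prod: "I \<star> J = R"
    using IJ by (auto simp: inverse_pair_def)
  have Jinf: "J \<star> \<sigma> ` Tinf = R \<star> \<sigma> ` Tinf"
    using localization_inverse_pair[OF Tinf_mem IJ] unfolding inverse_pair_def by (metis Iinf)
  have "A \<union> B \<subseteq> R \<star> \<sigma> ` Tinf"
    using AI BJ subset_localization[OF Tinf_mem, of I] subset_localization[OF Tinf_mem, of J] Iinf Jinf by blast
  moreover have "finite (A \<union> B)"
    by (simp add: A_def B_def)
  ultimately obtain E where E: "finite E" "\<And>T. T \<in> \<Theta> - E \<Longrightarrow> A \<union> B \<subseteq> R \<star> \<sigma> ` T"
    using finite_localization by metis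
  have "I \<star> \<sigma> ` T = R \<star> \<sigma> ` T" if T: "T \<in> \<Theta>" "T \<notin> E" for T
  proof -
    have AB: "A \<subseteq> R \<star> \<sigma> ` T" "B \<subseteq> R \<star> \<sigma> ` T"
      using E(2)[of T] T by auto
    have "I \<subseteq> I \<star> (A \<star> B)"
      by (rule set_prod_unit_superset[OF one])
    also have "\<dots> = A \<star> (I \<star> B)"
      by (simp add: set_prod_ac)
    also have "\<dots> \<subseteq> (R \<star> \<sigma> ` T) \<star> (I \<star> J)"
      using AB BJ by (intro set_prod_mono) auto
    finally have "I \<star> \<sigma> ` T \<subseteq> ((R \<star> \<sigma> ` T) \<star> R) \<star> \<sigma> ` T"
      unfolding prod by (intro set_prod_mono) auto
    also have "\<dots> = (R \<star> \<sigma> ` T) \<star> (R \<star> \<sigma> ` T)"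
      by (simp add: set_prod_ac)
    finally have 1: "I \<star> \<sigma> ` T \<subseteq> R \<star> \<sigma> ` T"
      by (simp add: localization_idem[OF T(1)])
    have "J \<subseteq> J \<star> (A \<star> B)"
      by (rule set_prod_unit_superset[OF one])
    also have "\<dots> = B \<star> (A \<star> J)"
      by (simp add: set_prod_ac)
    also have "\<dots> \<subseteq> (R \<star> \<sigma> ` T) \<star> (I \<star> J)"
      using AB AI by (intro set_prod_mono) auto
    finally have "J \<star> \<sigma> ` T \<subseteq> ((R \<star> \<sigma> ` T) \<star> R) \<star> \<sigma> ` T"
      unfolding prod by (intro set_prod_mono) auto
    also have "\<dots> = (R \<star> \<sigma> ` T) \<star> (R \<star> \<sigma> ` T)"
      by (simp add: set_prod_ac)
    finally have 2: "J \<star> \<sigma> ` T \<subseteq> R \<star> \<sigma> ` T"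
      by (simp add: localization_idem[OF T(1)])
    have "R \<star> \<sigma> ` T = (I \<star> \<sigma> ` T) \<star> (J \<star> \<sigma> ` T)"
      using localization_inverse_pair[OF T(1) IJ] by (simp add: inverse_pair_def)
    also have "\<dots> \<subseteq> (I \<star> \<sigma> ` T) \<star> (R \<star> \<sigma> ` T)"
      by (rule set_prod_mono[OF subset_refl 2])
    also have "\<dots> = I \<star> \<sigma> ` T"
      using localization_inverse_pair[OF T(1) IJ] by (simp add: inverse_pair_def set_prod_commute)
    finally show ?thesis using 1 by blast
  qed
  then have "{T\<in>\<Theta>. I \<star> \<sigma> ` T \<noteq> R \<star> \<sigma> ` T} \<subseteq> E" by blast
  then show ?thesis using E(1) finite_subset by blast
qed

end

subsection \<open>Integer-valued polynomials\<close>

lemma poly_fract_0 [simp]: "poly_fract 0 = 0"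
  and poly_fract_1 [simp]: "poly_fract 1 = 1"
  and poly_fract_add: "poly_fract (p + q) = poly_fract p + poly_fract q"
  and poly_fract_diff: "poly_fract (p - q) = poly_fract p - poly_fract q"
  and poly_fract_mult: "poly_fract (p * q) = poly_fract p * poly_fract q"
  by (simp_all add: poly_fract_def Zero_fract_def One_fract_def)

lemma poly_fract_eq_iff [simp]: "poly_fract p = poly_fract q \<longleftrightarrow> p = q"
  by (simp add: poly_fract_def eq_fract)

lemma poly_fract_eq_0_iff [simp]: "poly_fract p = 0 \<longleftrightarrow> p = 0"
  using poly_fract_eq_iff[of p 0] by simp

lemma field_embedding_const_fract: "field_embedding const_fract"
  by unfold_locales (simp_all add: const_fract_def flip: poly_fract_add poly_fract_mult one_pCons)

lemma const_fract_mult_poly_fract: "const_fract c * poly_fract p = poly_fract (smult c p)"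
  by (simp add: const_fract_def flip: poly_fract_mult)

lemma poly_fract_surj: obtains p q where "q \<noteq> 0" "x = poly_fract p / poly_fract q"
proof (cases x rule: Fract_cases)
  case (Fract p q)
  then show ?thesis
    using that[of q p] by (simp add: poly_fract_def)
qed

lemma image_poly_fract_set_prod: "poly_fract ` (I \<star> J) = poly_fract ` I \<star> poly_fract ` J"
  by (rule image_set_prod_hom) (simp_all add: poly_fract_add poly_fract_mult)

lemma image_Int_poly_ext: "poly_fract ` Int_poly_ext D T = poly_fract ` Int_poly D \<star> const_fract ` T"
proof -
  have "const_fract ` T = poly_fract ` ((\<lambda>t. [:t:]) ` T)"
    by (simp add: const_fract_def[abs_def] image_image)
  then show ?thesis
    by (simp add: Int_poly_ext_eq image_poly_fract_set_prod)
qed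

lemma poly_mem_subring:
  assumes "subring_of A" "\<And>i. coeff p i \<in> A" "a \<in> A"
  shows "poly p a \<in> A"
  using assms(2)
proof (induction p)
  case 0
  then show ?case using subring_ofD(1)[OF assms(1)] by simp
next
  case (pCons c p)
  have "c \<in> A" "\<And>i. coeff p i \<in> A"
    using pCons.prems[of 0] pCons.prems[of "Suc _"] by simp_all
  then show ?case
    using pCons.IH subring_ofD(3,5)[OF assms(1)] assms(3) by simp
qed

text \<open>Serves to turn a congruence between arguments into a congruence between values; the
  quotient is built along Horner's scheme.\<close>

lemma poly_diff_mem_subring:
  assumes A: "subring_of A" and p: "\<And>i. coeff p i \<in> A" and a: "a \<in> A" "b \<in> A"
  shows "\<exists>r\<in>A. poly p a - poly p b = (a - b) * r"
  using p
proof (induction p)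
  case 0
  then show ?case using subring_ofD(1)[OF A] by auto
next
  case (pCons c p)
  have p: "\<And>i. coeff p i \<in> A"
    using pCons.prems[of "Suc _"] by simp
  obtain r where r: "r \<in> A" "poly p a - poly p b = (a - b) * r"
    using pCons.IH[OF p] by blast
  have "poly (pCons c p) a - poly (pCons c p) b = a * (poly p a - poly p b) + (a - b) * poly p b"
    by (simp add: algebra_simps)
  also have "\<dots> = (a - b) * (a * r + poly p b)"
    unfolding r(2) by (simp add: algebra_simps)
  finally show ?case
    by (rule bexI) (rule subring_ofD(3)[OF A subring_ofD(5)[OF A a(1) r(1)] poly_mem_subring[OF A p a(2)]])
qed

lemma poly_common_denominator:
  assumes "domain_with_qf D"
  obtains b where "b \<in> D" "b \<noteq> 0" "\<And>i. b * coeff p i \<in> D"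
proof -
  have D: "subring_of D"
    using assms by (simp add: domain_with_qf_def)
  have "\<exists>b\<in>D. b \<noteq> 0 \<and> (\<forall>i. b * coeff p i \<in> D)"
  proof (induction p)
    case 0
    then show ?case
      using subring_ofD(1,2)[OF D] by (intro bexI[of _ 1]) simp_all
  next
    case (pCons c p)
    then obtain b where b: "b \<in> D" "b \<noteq> 0" "\<forall>i. b * coeff p i \<in> D" by blast
    obtain u v where uv: "u \<in> D" "v \<in> D" "v \<noteq> 0" "c = u / v"
      using assms unfolding domain_with_qf_def by blast
    have "v * b * coeff (pCons c p) i \<in> D" for i
    proof (cases i)
      case 0
      then show ?thesis
        using uv b(1) subring_ofD(5)[OF D, of b u] by simp
    next
      case (Suc j)
      then show ?thesis
        using subring_ofD(5)[OF D uv(2), of "b * coeff p j"] b(3) by (simp add: mult.assoc)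
    qed
    then show ?case
      using b uv subring_ofD(5)[OF D uv(2) b(1)] by (intro bexI[of _ "v * b"]) simp_all
  qed
  then show ?thesis using that by blast
qed

lemma smult_Int_poly:
  assumes "subring_of D" "\<And>i. b * coeff p i \<in> D"
  shows "smult b p \<in> Int_poly D"
  unfolding Int_poly_def using poly_mem_subring[OF assms(1), of "smult b p"] assms(2) by simp

lemma subring_Int_poly:
  assumes D: "subring_of D"
  shows "subring_of (poly_fract ` Int_poly D)"
  unfolding subring_of_def
proof (intro conjI ballI)
  have "0 \<in> Int_poly D" "1 \<in> Int_poly D"
    using subring_ofD(1,2)[OF D] by (simp_all add: Int_poly_def)
  then show "0 \<in> poly_fract ` Int_poly D" "1 \<in> poly_fract ` Int_poly D"
    by (metis image_eqI poly_fract_0, metis image_eqI poly_fract_1)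
  fix x y assume "x \<in> poly_fract ` Int_poly D" "y \<in> poly_fract ` Int_poly D"
  then obtain p q where pq: "p \<in> Int_poly D" "q \<in> Int_poly D" "x = poly_fract p" "y = poly_fract q"
    by blast
  have "p + q \<in> Int_poly D" "p - q \<in> Int_poly D" "p * q \<in> Int_poly D"
    using pq(1,2) subring_ofD(3-5)[OF D] by (simp_all add: Int_poly_def)
  then show "x + y \<in> poly_fract ` Int_poly D" "x - y \<in> poly_fract ` Int_poly D"
      "x * y \<in> poly_fract ` Int_poly D"
    unfolding pq(3,4) by (simp_all flip: poly_fract_add poly_fract_diff poly_fract_mult)
qed

lemma const_fract_subset_Int_poly: "const_fract ` D \<subseteq> poly_fract ` Int_poly D"
  by (auto simp: const_fract_def Int_poly_def)

lemma domain_with_qf_Int_poly: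
  assumes D: "domain_with_qf D"
  shows "domain_with_qf (poly_fract ` Int_poly D)"
  unfolding domain_with_qf_def
proof (intro conjI allI)
  have sD: "subring_of D"
    using D by (simp add: domain_with_qf_def)
  then show "subring_of (poly_fract ` Int_poly D)"
    by (rule subring_Int_poly)
  interpret field_embedding "const_fract :: 'a \<Rightarrow> 'a poly fract"
    by (rule field_embedding_const_fract)
  fix k :: "'a poly fract"
  obtain p q where pq: "q \<noteq> 0" "k = poly_fract p / poly_fract q"
    by (rule poly_fract_surj)
  obtain b where b: "b \<in> D" "b \<noteq> 0" "\<And>i. b * coeff p i \<in> D"
    using poly_common_denominator[OF D, of p] by blast
  obtain c where c: "c \<in> D" "c \<noteq> 0" "\<And>i. c * coeff q i \<in> D"
    using poly_common_denominator[OF D, of q] by blast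
  have cb: "c * b * coeff p i \<in> D" "c * b * coeff q i \<in> D" for i
    using subring_ofD(5)[OF sD c(1) b(3)] subring_ofD(5)[OF sD b(1) c(3)] by (simp_all add: mult_ac)
  have "k = poly_fract (smult (c * b) p) / poly_fract (smult (c * b) q)"
    using b(2) c(2) pq(2) by (simp flip: const_fract_mult_poly_fract)
  moreover have "poly_fract (smult (c * b) q) \<noteq> 0"
    using pq(1) b(2) c(2) by simp
  ultimately show "\<exists>a\<in>poly_fract ` Int_poly D. \<exists>b\<in>poly_fract ` Int_poly D. b \<noteq> 0 \<and> k = a / b"
    using smult_Int_poly[OF sD cb(1)] smult_Int_poly[OF sD cb(2)] by blast
qed

text \<open>Clearing the denominators of a polynomial puts it into D[X], hence into Int(D).\<close>

lemma Int_poly_localization_UNIV: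
  assumes D: "domain_with_qf D"
  shows "poly_fract ` Int_poly D \<star> const_fract ` UNIV = range poly_fract"
proof
  show "poly_fract ` Int_poly D \<star> const_fract ` UNIV \<subseteq> range poly_fract"
  proof (rule set_prod_subset)
    show "0 \<in> range poly_fract"
      using poly_fract_0 by (metis rangeI)
    show "x + y \<in> range poly_fract" if "x \<in> range poly_fract" "y \<in> range poly_fract"
      for x y :: "'a poly fract"
      using that by (auto simp flip: poly_fract_add)
    show "x * y \<in> range poly_fract" if "x \<in> poly_fract ` Int_poly D" "y \<in> range const_fract"
      for x y :: "'a poly fract"
      using that by (auto simp: const_fract_def simp flip: poly_fract_mult)
  qed
  interpret field_embedding "const_fract :: 'a \<Rightarrow> 'a poly fract"
    by (rule field_embedding_const_fract)
  have "poly_fract p \<in> poly_fract ` Int_poly D \<star> const_fract ` UNIV" for p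
  proof -
    obtain b where b: "b \<in> D" "b \<noteq> 0" "\<And>i. b * coeff p i \<in> D"
      using poly_common_denominator[OF D, of p] by blast
    have "poly_fract (smult b p) * const_fract (inverse b) \<in> poly_fract ` Int_poly D \<star> const_fract ` UNIV"
      using smult_Int_poly[OF _ b(3)] D by (intro set_prod_mult) (auto simp: domain_with_qf_def)
    also have "poly_fract (smult b p) * const_fract (inverse b) = poly_fract p"
      using b(2) by (simp add: emb_inverse flip: const_fract_mult_poly_fract)
    finally show ?thesis .
  qed
  then show "range poly_fract \<subseteq> poly_fract ` Int_poly D \<star> const_fract ` UNIV"
    by blast
qed

section \<open>The ring K[X] inside K(X): units and principal ideals\<close>

lemma subring_range_poly_fract: "subring_of (range (poly_fract :: 'a::field poly \<Rightarrow> _))"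
proof -
  have "Int_poly UNIV = (UNIV :: 'a poly set)"
    by (auto simp: Int_poly_def)
  moreover have "subring_of (UNIV :: 'a set)"
    by (simp add: subring_of_def)
  ultimately show ?thesis
    using subring_Int_poly[of "UNIV :: 'a set"] by simp
qed

lemma range_poly_fract_unit:
  assumes "x \<noteq> 0" "(\<lambda>r. x * r) ` range poly_fract = range poly_fract"
  obtains c where "x = const_fract c"
proof -
  have "1 \<in> range poly_fract"
    using poly_fract_1 by (metis rangeI)
  then have "x \<in> range poly_fract" "1 \<in> (\<lambda>r. x * r) ` range poly_fract"
    using assms(2) by (metis image_eqI mult.right_neutral, simp)
  then obtain p q where "x = poly_fract p" "1 = poly_fract (p * q)"
    by (auto simp: poly_fract_mult)
  then have x: "x = poly_fract p" "p * q = 1"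
    using poly_fract_eq_iff[of 1 "p * q"] by simp_all
  then obtain c where "p = [:c:]"
    using is_unit_poly_iff[of p] by (metis dvdI)
  then show ?thesis
    using that x(1) by (simp add: const_fract_def)
qed

text \<open>The usual division argument for ideals of K[X], applied to d I: the set \<open>P\<close>
  consists of the polynomials in d I, and an element \<open>p0\<close> of least degree generates
  it.\<close>

lemma range_poly_fract_principal:
  assumes I: "frac_ideal (range poly_fract) I"
  obtains h where "h \<noteq> 0" "I = (\<lambda>r. h * r) ` range poly_fract"
proof -
  have sub: "submodule_of (range poly_fract) I" and "I \<noteq> {0}"
    using I by (auto simp: frac_ideal_def)
  obtain d where d: "d \<noteq> 0" "\<And>x. x \<in> I \<Longrightarrow> d * x \<in> range poly_fract"
    using I unfolding frac_ideal_def by blast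
  have I0: "0 \<in> I" and I_add: "\<And>x y. x \<in> I \<Longrightarrow> y \<in> I \<Longrightarrow> x + y \<in> I"
    and I_mult: "\<And>p x. x \<in> I \<Longrightarrow> poly_fract p * x \<in> I"
    using sub unfolding submodule_of_def by auto
  define P where "P = {p. poly_fract p / d \<in> I}"
  have "\<exists>p. p \<in> P \<and> p \<noteq> 0"
  proof -
    obtain x where x: "x \<in> I" "x \<noteq> 0"
      using \<open>I \<noteq> {0}\<close> I0 by blast
    obtain p where p: "d * x = poly_fract p"
      using d(2)[OF x(1)] by blast
    then have "x = poly_fract p / d"
      using d(1) by (simp add: field_simps flip: p)
    then show ?thesis
      using x by (intro exI[of _ p]) (auto simp: P_def)
  qed
  then obtain p0 where p0: "p0 \<in> P" "p0 \<noteq> 0" "\<And>p. p \<in> P \<Longrightarrow> p \<noteq> 0 \<Longrightarrow> degree p0 \<le> degree p"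
    using exists_least_lemma[of "\<lambda>n. \<exists>p. p \<in> P \<and> p \<noteq> 0 \<and> degree p = n"]
      ex_has_least_nat[of "\<lambda>p. p \<in> P \<and> p \<noteq> 0" _ degree] by metis
  have dvd: "p0 dvd p" if p: "p \<in> P" for p
  proof -
    have "poly_fract p / d + poly_fract (- (p div p0)) * (poly_fract p0 / d) \<in> I"
      using p p0(1) unfolding P_def by (intro I_add I_mult) simp_all
    also have "poly_fract p / d + poly_fract (- (p div p0)) * (poly_fract p0 / d) =
        poly_fract (p + (- (p div p0)) * p0) / d"
      by (simp only: poly_fract_add poly_fract_mult add_divide_distrib times_divide_eq_right)
    also have "p + (- (p div p0)) * p0 = p mod p0"
      by (simp add: minus_div_mult_eq_mod)
    finally have "p mod p0 \<in> P"
      by (simp add: P_def)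
    then have "p mod p0 = 0"
      using p0(3)[of "p mod p0"] degree_mod_less[OF p0(2), of p] by fastforce
    then show ?thesis by blast
  qed
  show ?thesis
  proof (rule that[of "poly_fract p0 / d"])
    show "poly_fract p0 / d \<noteq> 0"
      using p0(2) d(1) by simp
    show "I = (\<lambda>r. poly_fract p0 / d * r) ` range poly_fract"
    proof
      show "I \<subseteq> (\<lambda>r. poly_fract p0 / d * r) ` range poly_fract"
      proof
        fix x assume x: "x \<in> I"
        obtain p where p: "d * x = poly_fract p"
          using d(2)[OF x] by blast
        then have xp: "x = poly_fract p / d"
          using d(1) by (simp add: field_simps flip: p)
        then obtain q where "p = p0 * q"
          using dvd[of p] x by (auto simp: P_def)
        then have "x = poly_fract p0 / d * poly_fract q"
          using xp by (simp add: poly_fract_mult)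
        then show "x \<in> (\<lambda>r. poly_fract p0 / d * r) ` range poly_fract"
          by blast
      qed
      show "(\<lambda>r. poly_fract p0 / d * r) ` range poly_fract \<subseteq> I"
        using I_mult[of "poly_fract p0 / d"] p0(1) by (auto simp: P_def mult.commute)
    qed
  qed
qed

section \<open>Integer-valued polynomials over the members of the family\<close>

context pointed_family
begin

text \<open>The claim is T = D + x T, and it is checked locally on the \<open>D\<close>-module
  \<open>N\<close>, which is D + x T. At \<open>T\<close> the summand D already produces T; at
  another member \<open>S\<close> the summand x T produces x T S = K by independence.\<close>

lemma approximation:
  assumes T: "T \<in> \<Theta>" and t: "t \<in> T" and x: "x \<noteq> 0"
  obtains d where "d \<in> D" "(t - d) / x \<in> T"
proof -
  note local_subset = embedded_family.local_subset[OF embedded_family.intro[OF field_embedding_id pointed_family_axioms]]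
  define N where "N = {y. \<exists>d\<in>D. (y - d) / x \<in> T}"
  note sD = subring_ofD[OF subring_base] and sT = subring_ofD[OF subring_mem[OF T]]
  have "submodule_of D N"
    unfolding submodule_of_def
  proof (intro conjI ballI)
    show "0 \<in> N"
      unfolding N_def using sD(1) sT(1) by (intro CollectI bexI[of _ 0]) simp_all
    show "y + z \<in> N" if yz: "y \<in> N" "z \<in> N" for y z
    proof -
      obtain d e where de: "d \<in> D" "(y - d) / x \<in> T" "e \<in> D" "(z - e) / x \<in> T"
        using yz unfolding N_def by blast
      have "(y + z - (d + e)) / x = (y - d) / x + (z - e) / x"
        by (simp add: diff_divide_distrib add_divide_distrib)
      then show ?thesis
        unfolding N_def using sT(3)[OF de(2,4)] sD(3)[OF de(1,3)] by (intro CollectI bexI[of _ "d + e"]) simp_all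
    qed
    show "c * y \<in> N" if c: "c \<in> D" and y: "y \<in> N" for c y
    proof -
      obtain d where d: "d \<in> D" "(y - d) / x \<in> T"
        using y unfolding N_def by blast
      have "(c * y - c * d) / x = c * ((y - d) / x)"
        by (simp add: right_diff_distrib)
      also have "\<dots> \<in> T"
        using c base_subset[OF T] by (intro sT(5)[OF _ d(2)]) blast
      finally show ?thesis
        unfolding N_def using sD(5)[OF c d(1)] by (intro CollectI bexI[of _ "c * d"])
    qed
  qed
  then have DN: "D \<star> N = N"
    using set_prod_eq_submodule[OF sD(2)] by blast
  have DsubN: "D \<subseteq> N"
  proof
    show "d \<in> N" if "d \<in> D" for d
      unfolding N_def using sT(1) that by (intro CollectI bexI[of _ d]) simp_all
  qed
  have xT: "(\<lambda>u. x * u) ` T \<subseteq> N"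
    unfolding N_def using x sD(1) by (auto intro!: bexI[of _ 0])
  have "T \<subseteq> N"
  proof (rule local_subset)
    fix S assume S: "S \<in> \<Theta>"
    have "T \<star> S \<subseteq> N \<star> S"
    proof (cases "S = T")
      case True
      have "D \<star> T \<subseteq> N \<star> T"
        by (rule set_prod_mono[OF DsubN subset_refl])
      then show ?thesis
        using True by (simp add: base_module[OF T] set_prod_subring[OF subring_mem[OF T]])
    next
      case False
      have "UNIV \<subseteq> (\<lambda>u. x * u) ` UNIV"
      proof
        fix v show "v \<in> (\<lambda>u. x * u) ` UNIV"
          using x by (intro image_eqI[of _ _ "v / x"]) simp_all
      qed
      also have "\<dots> = ((\<lambda>u. x * u) ` T) \<star> S"
        using independent[OF T S] False by (simp add: scale_set_prod)
      also have "\<dots> \<subseteq> N \<star> S"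
        by (rule set_prod_mono[OF xT subset_refl])
      finally show ?thesis by blast
    qed
    then show "T \<star> (\<lambda>x. x) ` S \<subseteq> N \<star> (\<lambda>x. x) ` S" by simp
  qed (simp_all add: DN base_module[OF T])
  then show ?thesis
    using that t unfolding N_def by blast
qed

text \<open>Choose x with x f in D[X] and approximate t by some d in \<open>D\<close> modulo x T.
  Then x f(t) - x f(d) = (t - d) r with r in \<open>T\<close>, and (t - d) / x lies in
  \<open>T\<close>, so f(t) differs from f(d) by an element of \<open>T\<close>.\<close>

lemma Int_poly_subset:
  assumes T: "T \<in> \<Theta>"
  shows "Int_poly D \<subseteq> Int_poly T"
proof (intro subsetI, unfold Int_poly_def, intro CollectI ballI)
  fix f t assume "f \<in> {f. \<forall>a\<in>D. poly f a \<in> D}" and t: "t \<in> T"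
  then have f: "\<And>a. a \<in> D \<Longrightarrow> poly f a \<in> D" by blast
  obtain x where x: "x \<in> D" "x \<noteq> 0" "\<And>i. x * coeff f i \<in> D"
    using poly_common_denominator[OF qf, of f] by blast
  obtain d where d: "d \<in> D" "(t - d) / x \<in> T"
    using approximation[OF T t x(2)] .
  note sT = subring_ofD[OF subring_mem[OF T]]
  have "\<exists>r\<in>T. poly (smult x f) t - poly (smult x f) d = (t - d) * r"
    using x(3) d(1) base_subset[OF T] by (intro poly_diff_mem_subring[OF subring_mem[OF T]] t) auto
  then obtain r where r: "r \<in> T" "x * poly f t - x * poly f d = (t - d) * r"
    by auto
  have "x * (poly f t - poly f d) = x * ((t - d) / x * r)"
    using r(2) x(2) by (simp add: right_diff_distrib)
  then have "poly f t - poly f d = (t - d) / x * r"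
    using x(2) by (simp only: mult_cancel_left simp_thms)
  then have "poly f t = (t - d) / x * r + poly f d"
    by (simp add: algebra_simps)
  then show "poly f t \<in> T"
    using sT(3)[OF sT(5)[OF d(2) r(1)]] f[OF d(1)] base_subset[OF T] by auto
qed

lemma Int_poly_localization:
  assumes T: "T \<in> \<Theta>" "T \<noteq> Tinf"
  shows "poly_fract ` Int_poly D \<star> const_fract ` T = poly_fract ` Int_poly T"
proof
  note sT = subring_ofD[OF subring_mem[OF T(1)]]
  interpret embedded_family "const_fract :: 'a \<Rightarrow> 'a poly fract" D \<Theta> Tinf
    by (intro embedded_family.intro field_embedding_const_fract pointed_family_axioms)
  have module: "const_fract ` D \<star> poly_fract ` Int_poly D = poly_fract ` Int_poly D"
    by (rule overring_module[OF subring_image_base subring_Int_poly[OF subring_base] const_fract_subset_Int_poly])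
  have "poly_fract ` Int_poly D \<star> const_fract ` T \<subseteq> poly_fract ` Int_poly T \<star> poly_fract ` Int_poly T"
    using Int_poly_subset[OF T(1)] const_fract_subset_Int_poly by (intro set_prod_mono image_mono)
  then show "poly_fract ` Int_poly D \<star> const_fract ` T \<subseteq> poly_fract ` Int_poly T"
    using set_prod_subring[OF subring_Int_poly[OF subring_mem[OF T(1)]]] by simp
  show "poly_fract ` Int_poly T \<subseteq> poly_fract ` Int_poly D \<star> const_fract ` T"
  proof (rule image_subsetI)
    fix g assume g: "g \<in> Int_poly T"
    obtain b where b: "b \<in> D" "b \<noteq> 0" "\<And>i. b * coeff g i \<in> D"
      using poly_common_denominator[OF qf, of g] by blast
    have "c \<in> colon D (poly_fract ` Int_poly D) (poly_fract g)"
      if c: "c \<in> D" "\<And>S. S \<in> \<Theta> \<Longrightarrow> S \<noteq> T \<Longrightarrow> c / b \<in> S" for c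
    proof -
      have "c * poly g a \<in> D" if a: "a \<in> D" for a
      proof (rule mem_baseI)
        fix S assume S: "S \<in> \<Theta>"
        show "c * poly g a \<in> S"
        proof (cases "S = T")
          case True
          then show ?thesis
            using a c(1) g base_subset[OF T(1)] by (auto simp: Int_poly_def intro: sT(5))
        next
          case False
          have "poly (smult b g) a \<in> D"
            using smult_Int_poly[OF subring_base b(3)] a by (auto simp: Int_poly_def)
          then have "(c / b) * poly (smult b g) a \<in> S"
            using c(2)[OF S False] base_subset[OF S] by (intro subring_ofD(5)[OF subring_mem[OF S]]) auto
          then show ?thesis
            using b(2) by simp
        qed
      qed
      then have "smult c g \<in> Int_poly D"
        by (simp add: Int_poly_def)
      then show ?thesis
        using c(1) by (simp add: colon_def const_fract_mult_poly_fract)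
    qed
    then have "{c\<in>D. \<forall>S\<in>\<Theta>-{T}. c / b \<in> S} \<subseteq> colon D (poly_fract ` Int_poly D) (poly_fract g)"
      by blast
    then have "dense_in (colon D (poly_fract ` Int_poly D) (poly_fract g)) T"
      by (rule dense_in_mono[OF jaffard_dense[OF T(1) jaffard_mem[OF T] b(1,2)]])
    then show "poly_fract g \<in> poly_fract ` Int_poly D \<star> const_fract ` T"
      using mem_localization_iff[OF qf flat[OF T(1)] module] by blast
  qed
qed

end

subsection \<open>The exact sequence\<close>

lemma inverse_pair_UNIV:
  assumes "subring_of A" "inverse_pair A B B'"
  shows "B \<star> UNIV = UNIV"
proof -
  have "UNIV \<subseteq> A \<star> UNIV"
    using set_prod_unit_superset[OF subring_ofD(2)[OF assms(1)], of UNIV] by (simp add: set_prod_commute)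
  also have "\<dots> = B \<star> (B' \<star> UNIV)"
    using assms(2) by (simp add: inverse_pair_def flip: set_prod_assoc)
  also have "\<dots> \<subseteq> B \<star> UNIV"
    by (rule set_prod_mono) auto
  finally show ?thesis by blast
qed

lemma pair_choice:
  assumes "\<And>x. x \<in> X \<Longrightarrow> \<exists>a b. Q x a b"
  shows "\<exists>f g. \<forall>x\<in>X. Q x (f x) (g x)"
  using assms by metis

context field_embedding
begin

lemma UNIV_idem: "\<sigma> ` UNIV \<star> \<sigma> ` UNIV = \<sigma> ` UNIV"
  by (rule set_prod_subring[OF subring_of_image]) (simp add: subring_of_def)

lemma image_inverse_pair_UNIV:
  assumes "subring_of A" "inverse_pair A B B'"
  shows "\<sigma> ` B \<star> \<sigma> ` UNIV = \<sigma> ` UNIV"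
  using inverse_pair_UNIV[OF assms] by (simp flip: image_set_prod)

lemma image_scale: "\<sigma> ` (\<lambda>r. k * r) ` B = (\<lambda>r. \<sigma> k * r) ` \<sigma> ` B"
  by (simp add: image_image emb_mult)

lemma extend_inverse_pair_UNIV:
  assumes "inverse_pair S I J"
  shows "inverse_pair (S \<star> \<sigma> ` UNIV) (I \<star> \<sigma> ` UNIV) (J \<star> \<sigma> ` UNIV)"
proof -
  have "(X \<star> \<sigma> ` UNIV) \<star> (Y \<star> \<sigma> ` UNIV) = (X \<star> Y) \<star> \<sigma> ` UNIV" for X Y
  proof -
    have "(X \<star> \<sigma> ` UNIV) \<star> (Y \<star> \<sigma> ` UNIV) = (X \<star> Y) \<star> (\<sigma> ` UNIV \<star> \<sigma> ` UNIV)"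
      by (simp only: set_prod_ac)
    then show ?thesis by (simp only: UNIV_idem)
  qed
  then show ?thesis
    using assms by (simp add: inverse_pair_def)
qed

lemma unitary_inverse:
  assumes "inverse_pair S I J" "I \<star> \<sigma> ` UNIV = S \<star> \<sigma> ` UNIV"
  shows "J \<star> \<sigma> ` UNIV = S \<star> \<sigma> ` UNIV"
  using extend_inverse_pair_UNIV[OF assms(1)] assms(2) unfolding inverse_pair_def by metis

end

interpretation const: field_embedding "const_fract :: 'a::field \<Rightarrow> 'a poly fract"
  by (rule field_embedding_const_fract)

text \<open>Over K[X] the extended ideal is invertible, hence principal; dividing by a generator
  turns it into K[X].\<close>

lemma unitary_representative:
  fixes S :: "'a::field poly fract set"
  assumes S: "domain_with_qf S" "S \<star> const_fract ` UNIV = range poly_fract" and IJ: "inverse_pair S I J"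
  obtains h where "h \<noteq> 0" "((\<lambda>r. h * r) ` I) \<star> const_fract ` UNIV = range poly_fract"
proof -
  have 1: "1 \<in> const_fract ` (UNIV :: 'a set)"
    using const.emb_one by (metis rangeI)
  have "S \<subseteq> range poly_fract"
    using set_prod_unit_superset[OF 1, of S] unfolding S(2) .
  then have "domain_with_qf (range (poly_fract :: 'a poly \<Rightarrow> _))"
    using domain_with_qf_superset[OF S(1) subring_range_poly_fract] by blast
  moreover have "inverse_pair (range poly_fract) (I \<star> const_fract ` UNIV) (J \<star> const_fract ` UNIV)"
    using const.extend_inverse_pair_UNIV[OF IJ] unfolding S(2) .
  ultimately have "frac_ideal (range poly_fract) (I \<star> const_fract ` UNIV)"
    by (rule inverse_pair_frac_ideal)
  then obtain h where h: "h \<noteq> 0" "I \<star> const_fract ` UNIV = (\<lambda>r. h * r) ` range poly_fract"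
    by (rule range_poly_fract_principal)
  have "((\<lambda>r. inverse h * r) ` I) \<star> const_fract ` UNIV = range poly_fract"
    unfolding scale_set_prod h(2) scale_scale using h(1) by simp
  then show ?thesis
    using that[of "inverse h"] h(1) by simp
qed

text \<open>The scaling factor must be a unit of \<open>K[X]\<close>, that is, a nonzero constant.\<close>
lemma unitary_scale_const:
  fixes I :: "'a::field poly fract set"
  assumes I: "I \<star> const_fract ` UNIV = range poly_fract" and J: "J \<star> const_fract ` UNIV = range poly_fract"
    and A: "subring_of A" "inverse_pair A B B'" and x: "x \<noteq> 0" "J = (\<lambda>r. x * r) ` (I \<star> const_fract ` B)"
  obtains C C' where "inverse_pair A C C'" "J = I \<star> const_fract ` C"
proof -
  have "range poly_fract = (\<lambda>r. x * r) ` (I \<star> (const_fract ` B \<star> const_fract ` UNIV))"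
    using J unfolding x(2) scale_set_prod by (simp add: set_prod_assoc)
  then have "(\<lambda>r. x * r) ` range poly_fract = range poly_fract"
    by (simp add: const.image_inverse_pair_UNIV[OF A] I)
  then obtain k where k: "x = const_fract k"
    using range_poly_fract_unit x(1) by blast
  then have "k \<noteq> 0" using x(1) by auto
  from inverse_pair_scale[OF A(2) this] show ?thesis
    by (rule that) (simp add: x(2) k const.image_scale set_prod_scale)
qed

section \<open>Classes of unitary ideals over Int(D) and its localizations\<close>

context pointed_family
begin

abbreviation "IntD \<equiv> poly_fract ` Int_poly D"
text \<open>For a member other than \<open>Tinf\<close> this is Int(T), for \<open>Tinf\<close> it
  is the ring occurring in \<open>PicInt2\<close>. Treating both as localizations of Int(D) lets all
  members share the same lemmas.\<close>

abbreviation "loc T \<equiv> IntD \<star> const_fract ` T"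
abbreviation "classD \<equiv> quot_class D IntD const_fract"
abbreviation "class T \<equiv> quot_class T (loc T) const_fract"

lemma embedded_ring_Int: "embedded_ring const_fract D \<Theta> Tinf IntD"
  by (intro embedded_ring.intro embedded_family.intro embedded_ring_axioms.intro field_embedding_const_fract
      pointed_family_axioms subring_Int_poly[OF subring_base] const_fract_subset_Int_poly)

lemma embedded_ring_base: "embedded_ring (\<lambda>x. x) D \<Theta> Tinf D"
  by (intro embedded_ring.intro embedded_family.intro embedded_ring_axioms.intro field_embedding_id
      pointed_family_axioms subring_base) simp

interpretation Int: embedded_ring const_fract D \<Theta> Tinf IntD
  by (rule embedded_ring_Int)

lemma qf_mem: "T \<in> \<Theta> \<Longrightarrow> domain_with_qf T"
  by (rule domain_with_qf_superset[OF qf subring_mem base_subset])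

lemma qf_IntD: "domain_with_qf IntD"
  by (rule domain_with_qf_Int_poly[OF qf])

lemma qf_loc: "T \<in> \<Theta> \<Longrightarrow> domain_with_qf (loc T)"
  by (rule domain_with_qf_superset[OF qf_IntD Int.subring_localization Int.subset_localization])

lemma IntD_UNIV: "IntD \<star> const_fract ` UNIV = range poly_fract"
  by (rule Int_poly_localization_UNIV[OF qf])

lemma loc_UNIV: "T \<in> \<Theta> \<Longrightarrow> loc T \<star> const_fract ` UNIV = range poly_fract"
  by (simp add: Int.localization_UNIV IntD_UNIV)

lemma pic_extension_base: "pic_extension const_fract D IntD"
  by (intro pic_extension.intro pic_extension_axioms.intro field_embedding_const_fract qf qf_IntD
      const_fract_subset_Int_poly)

lemma image_subset_loc: "const_fract ` T \<subseteq> loc T"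
  unfolding set_prod_commute[of IntD] by (rule set_prod_unit_superset[OF subring_ofD(2)[OF Int.subring_R]])

lemma pic_extension_mem: "T \<in> \<Theta> \<Longrightarrow> pic_extension const_fract T (loc T)"
  by (intro pic_extension.intro pic_extension_axioms.intro field_embedding_const_fract qf_mem qf_loc
      image_subset_loc)

lemma PicInt_mem: "T \<in> \<Theta> \<Longrightarrow> T \<noteq> Tinf \<Longrightarrow> PicInt T = Pic_quot T (loc T) const_fract"
  by (simp add: PicInt_def Int_poly_localization)

lemma PicInt2_Tinf: "PicInt2 D Tinf = Pic_quot Tinf (loc Tinf) const_fract"
  by (simp add: PicInt2_def image_Int_poly_ext)

lemma localization_base_inverse_pair:
  assumes "T \<in> \<Theta>" "inverse_pair D B B'"
  shows "inverse_pair T (B \<star> T) (B' \<star> T)"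
  using embedded_ring.localization_inverse_pair[OF embedded_ring_base assms] base_module[OF assms(1)] by simp

lemma localization_twist:
  "T \<in> \<Theta> \<Longrightarrow> (I \<star> const_fract ` B) \<star> const_fract ` T = (I \<star> const_fract ` T) \<star> const_fract ` (B \<star> T)"
  by (simp add: Int.localization_mult const.image_set_prod)

lemma twist_inverse_pair:
  assumes "inverse_pair IntD I I'" "inverse_pair D B B'"
  shows "inverse_pair IntD (I \<star> const_fract ` B) (I' \<star> const_fract ` B')"
proof -
  have "inverse_pair IntD (ext_ideal IntD const_fract B) (ext_ideal IntD const_fract B')"
    by (rule pic_extension.inverse_pair_ext_ideal[OF pic_extension_base assms(2)])
  from inverse_pair_mult[OF Int.subring_R assms(1) this]
  have "inverse_pair IntD ((I \<star> IntD) \<star> const_fract ` B) ((I' \<star> IntD) \<star> const_fract ` B')"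
    by (simp only: ext_ideal_eq set_prod_assoc)
  then show ?thesis
    using assms(1) unfolding set_prod_commute[of _ IntD] inverse_pair_def by simp
qed

text \<open>Equality of classes is witnessed by the scalar 1 and the ideal \<open>B\<close>. This
  allows an ideal of Int(D) to be corrected by a glued or lifted ideal of \<open>D\<close>.\<close>

lemma classD_twist:
  assumes "inverse_pair IntD I I'" "inverse_pair D B B'"
  shows "classD (I \<star> const_fract ` B) = classD I"
proof -
  have "classD I = classD (I \<star> const_fract ` B)"
    unfolding pic_extension.quot_class_eq_iff[OF pic_extension_base
        inv_frac_ideal_iff[OF qf_IntD, THEN iffD2, OF exI[of _ I'], OF assms(1)]
        inv_frac_ideal_iff[OF qf_IntD, THEN iffD2, OF exI, OF twist_inverse_pair[OF assms]]]
    using inv_frac_ideal_iff[OF qf] assms(2) by (intro exI[of _ 1] exI[of _ B]) auto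
  then show ?thesis ..
qed

lemma class_eqI:
  assumes T: "T \<in> \<Theta>" and I: "inverse_pair (loc T) I I'" and J: "inverse_pair (loc T) J J'"
    and B: "inverse_pair T B B'" and x: "x \<noteq> 0" "J = (\<lambda>r. x * r) ` (I \<star> const_fract ` B)"
  shows "class T I = class T J"
  using pic_extension.quot_class_eq_iff[OF pic_extension_mem[OF T], of I J] I J B x
  by (auto simp: inv_frac_ideal_iff[OF qf_loc[OF T]] inv_frac_ideal_iff[OF qf_mem[OF T]])

text \<open>Between unitary representatives the scalar is a constant and disappears into the ideal
  of \<open>T\<close>. What remains is an equality of ideals, to which gluing and lifting
  apply.\<close>

lemma class_eqD:
  assumes T: "T \<in> \<Theta>" and I: "inverse_pair (loc T) I I'" "I \<star> const_fract ` UNIV = range poly_fract"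
    and J: "inverse_pair (loc T) J J'" "J \<star> const_fract ` UNIV = range poly_fract"
    and eq: "class T I = class T J"
  obtains B B' where "inverse_pair T B B'" "J = I \<star> const_fract ` B"
proof -
  have inv: "inv_frac_ideal (loc T) I" "inv_frac_ideal (loc T) J"
    using I J by (auto simp: inv_frac_ideal_iff[OF qf_loc[OF T]])
  obtain x A where x: "x \<noteq> 0" "inv_frac_ideal T A" "J = (\<lambda>r. x * r) ` (I \<star> const_fract ` A)"
    using pic_extension.quot_class_eq_iff[OF pic_extension_mem[OF T] inv] eq by blast
  obtain A' where "inverse_pair T A A'"
    using x(2) inv_frac_ideal_iff[OF qf_mem[OF T]] by blast
  then show ?thesis
    using unitary_scale_const[OF I(2) J(2) subring_mem[OF T] _ x(1,3)] that by blast
qed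

lemma class_surj:
  assumes T: "T \<in> \<Theta>" and u: "u \<in> carrier (Pic_quot T (loc T) const_fract)"
  obtains J J' where "inverse_pair (loc T) J J'" "J \<star> const_fract ` UNIV = range poly_fract"
    "class T J = u"
proof -
  obtain I where I: "inv_frac_ideal (loc T) I" "u = class T I"
    using u pic_extension.quot_class_carrier[OF pic_extension_mem[OF T]] by auto
  obtain I' where I': "inverse_pair (loc T) I I'"
    using I(1) inv_frac_ideal_iff[OF qf_loc[OF T]] by blast
  obtain h where h: "h \<noteq> 0" "((\<lambda>r. h * r) ` I) \<star> const_fract ` UNIV = range poly_fract"
    using unitary_representative[OF qf_loc[OF T] loc_UNIV[OF T] I'] by blast
  note hI = inverse_pair_scale[OF I' h(1)]
  have "inverse_pair T T T"
    by (simp add: inverse_pair_def set_prod_subring[OF subring_mem[OF T]])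
  moreover have "I \<star> const_fract ` T = I"
  proof -
    have "loc T \<star> (I \<star> const_fract ` T) = (IntD \<star> (const_fract ` T \<star> const_fract ` T)) \<star> I"
      by (simp only: set_prod_ac)
    also have "\<dots> = I"
      using I' by (simp only: Int.image_idem[OF T] inverse_pair_def)
    finally have 1: "loc T \<star> (I \<star> const_fract ` T) = I" .
    have "loc T \<star> (I \<star> const_fract ` T) = (loc T \<star> I) \<star> const_fract ` T"
      by (simp only: set_prod_assoc)
    with 1 show ?thesis
      using I' by (simp only: inverse_pair_def)
  qed
  ultimately have "class T I = class T ((\<lambda>r. h * r) ` I)"
    using class_eqI[OF T I' hI _ h(1)] by simp
  then show ?thesis
    using that[OF hI h(2)] I(2) by simp
qed

lemma class_localization_eq:
  assumes T: "T \<in> \<Theta>" and I: "inv_frac_ideal IntD I" and J: "inv_frac_ideal IntD J"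
    and eq: "classD I = classD J"
  shows "class T (I \<star> const_fract ` T) = class T (J \<star> const_fract ` T)"
proof -
  obtain x A where x: "x \<noteq> 0" "inv_frac_ideal D A" "J = (\<lambda>r. x * r) ` (I \<star> const_fract ` A)"
    using pic_extension.quot_class_eq_iff[OF pic_extension_base I J] eq by blast
  obtain A' where A': "inverse_pair D A A'"
    using x(2) inv_frac_ideal_iff[OF qf] by blast
  obtain I' where I': "inverse_pair IntD I I'"
    using I inv_frac_ideal_iff[OF qf_IntD] by blast
  obtain J' where J': "inverse_pair IntD J J'"
    using J inv_frac_ideal_iff[OF qf_IntD] by blast
  have "J \<star> const_fract ` T = (\<lambda>r. x * r) ` ((I \<star> const_fract ` T) \<star> const_fract ` (A \<star> T))"
    unfolding x(3) scale_set_prod localization_twist[OF T] ..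
  then show ?thesis
    by (rule class_eqI[OF T Int.localization_inverse_pair[OF T I'] Int.localization_inverse_pair[OF T J']
          localization_base_inverse_pair[OF T A'] x(1)])
qed

lemma exact_sequence:
  "\<exists>f g. f \<in> hom (sum_group (\<Theta> - {Tinf}) PicInt) (PicInt D) \<and>
         inj_on f (carrier (sum_group (\<Theta> - {Tinf}) PicInt)) \<and>
         g \<in> hom (PicInt D) (PicInt2 D Tinf) \<and>
         g ` carrier (PicInt D) = carrier (PicInt2 D Tinf) \<and>
         f ` carrier (sum_group (\<Theta> - {Tinf}) PicInt) = kernel (PicInt D) (PicInt2 D Tinf) g"
proof -
  let ?c = "const_fract :: 'a \<Rightarrow> 'a poly fract"
  let ?V = "range (poly_fract :: 'a poly \<Rightarrow> 'a poly fract)"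
  let ?G = "sum_group (\<Theta> - {Tinf}) PicInt"
  note base = pic_extension_base and mem = pic_extension_mem
  note inv_iff = inv_frac_ideal_iff[OF qf_IntD] inv_frac_ideal_iff[OF qf_loc]
  have PicInt_D: "PicInt D = Pic_quot D IntD ?c"
    by (simp add: PicInt_def)
  have group: "group (PicInt T)" if "T \<in> \<Theta> - {Tinf}" for T
    using pic_extension.group_Pic_quot[OF mem] that by (simp add: PicInt_mem)
  \<comment> \<open>The condition at \<open>Tinf\<close> is an equality of ideals, not of classes.
    It forces the generic fibre K[X] and makes the localizations trivial at all but finitely many
    members.\<close>
  define P where "P = {I. (\<exists>I'. inverse_pair IntD I I') \<and> I \<star> ?c ` Tinf = loc Tinf}"
  define \<psi> where "\<psi> I = (\<lambda>T\<in>\<Theta>-{Tinf}. class T (I \<star> ?c ` T))" for I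
  have P_UNIV: "I \<star> ?c ` UNIV = ?V" if "I \<in> P" for I
  proof -
    have "I \<star> ?c ` UNIV = (I \<star> ?c ` Tinf) \<star> ?c ` UNIV"
      by (simp only: Int.localization_UNIV[OF Tinf_mem])
    then show ?thesis
      using that by (simp add: P_def loc_UNIV[OF Tinf_mem])
  qed
  have P_loc: "inv_frac_ideal (loc T) (I \<star> ?c ` T)" if "I \<in> P" "T \<in> \<Theta>" for I T
    using that Int.localization_inverse_pair[OF that(2)] by (auto simp: P_def inv_iff(2)[OF that(2)])
  have P_mult: "I \<star> J \<in> P" if "I \<in> P" "J \<in> P" for I J
  proof -
    have "\<exists>K. inverse_pair IntD (I \<star> J) K"
      using that inverse_pair_mult[OF Int.subring_R] unfolding P_def by blast
    then show ?thesis
      using that by (simp add: P_def Int.localization_mult[OF Tinf_mem] Int.localization_idem[OF Tinf_mem])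
  qed
  have carrier_G: "carrier ?G = {x \<in> \<Pi>\<^sub>E T\<in>\<Theta>-{Tinf}. carrier (PicInt T). finite {T \<in> \<Theta>-{Tinf}. x T \<noteq> \<one>\<^bsub>PicInt T\<^esub>}}"
    by (rule carrier_sum_group[OF group])
  have \<psi>_carrier: "\<psi> I \<in> carrier ?G" if I: "I \<in> P" for I
  proof -
    have 1: "class T (I \<star> ?c ` T) \<in> carrier (PicInt T)" if T: "T \<in> \<Theta> - {Tinf}" for T
      using pic_extension.quot_class_carrier[OF mem] P_loc[OF I] T by (auto simp: PicInt_mem)
    obtain I' where I': "inverse_pair IntD I I'" "I \<star> ?c ` Tinf = loc Tinf"
      using I by (auto simp: P_def)
    have "{T \<in> \<Theta>-{Tinf}. \<psi> I T \<noteq> \<one>\<^bsub>PicInt T\<^esub>} \<subseteq> {T\<in>\<Theta>. I \<star> ?c ` T \<noteq> loc T}"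
      using pic_extension.quot_class_one[OF mem] by (auto simp: \<psi>_def PicInt_mem)
    then have "finite {T \<in> \<Theta>-{Tinf}. \<psi> I T \<noteq> \<one>\<^bsub>PicInt T\<^esub>}"
      using Int.finite_nontrivial[OF I'] finite_subset by blast
    then show ?thesis
      unfolding carrier_G using 1 by (auto simp: \<psi>_def)
  qed
  have \<psi>_surj: "u \<in> \<psi> ` P" if u: "u \<in> carrier ?G" for u
  proof -
    let ?E = "{T \<in> \<Theta>-{Tinf}. u T \<noteq> \<one>\<^bsub>PicInt T\<^esub>}"
    have uT: "u T \<in> carrier (Pic_quot T (loc T) ?c)" if "T \<in> \<Theta> - {Tinf}" for T
      using u that unfolding carrier_G by (auto simp: PicInt_mem[symmetric])
    have fin: "finite ?E"
      using u unfolding carrier_G by blast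
    have loc_pair: "inverse_pair (loc T) (loc T) (loc T)" if "T \<in> \<Theta>" for T
      by (simp add: inverse_pair_def Int.localization_idem[OF that])
    \<comment> \<open>Off the finite support, and in particular at \<open>Tinf\<close>, the
      representative is \<open>loc T\<close> itself and not merely an ideal of trivial class,
      because gluing compares the local ideals with one global module, here Int(D).\<close>
    have ex: "\<exists>J J'. inverse_pair (loc T) J J' \<and> J \<star> ?c ` UNIV = ?V \<and> (T \<noteq> Tinf \<longrightarrow> class T J = u T) \<and>
        (T \<notin> ?E \<longrightarrow> J = loc T \<and> J' = loc T)" if T: "T \<in> \<Theta>" for T
    proof (cases "T \<in> ?E")
      case True
      then have "T \<in> \<Theta> - {Tinf}" by blast
      then obtain J J' where "inverse_pair (loc T) J J'" "J \<star> ?c ` UNIV = ?V" "class T J = u T"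
        by (rule class_surj[OF T uT])
      then show ?thesis
        using True by (intro exI[of _ J] exI[of _ J'] conjI impI) auto
    next
      case False
      have "class T (loc T) = u T" if "T \<noteq> Tinf"
      proof -
        have "u T = \<one>\<^bsub>PicInt T\<^esub>"
          using False T that by blast
        then show ?thesis
          by (simp only: PicInt_mem[OF T that] pic_extension.quot_class_one[OF mem[OF T]])
      qed
      then show ?thesis
        using loc_pair[OF T] loc_UNIV[OF T] by (intro exI[of _ "loc T"] conjI impI) simp_all
    qed
    obtain N N' where NN': "\<forall>T\<in>\<Theta>. inverse_pair (loc T) (N T) (N' T) \<and>
        N T \<star> ?c ` UNIV = ?V \<and> (T \<noteq> Tinf \<longrightarrow> class T (N T) = u T) \<and> (T \<notin> ?E \<longrightarrow> N T = loc T \<and> N' T = loc T)"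
      by atomize_elim (rule pair_choice, rule ex)
    have N: "\<And>T. T \<in> \<Theta> \<Longrightarrow> inverse_pair (loc T) (N T) (N' T)"
        "\<And>T. T \<in> \<Theta> \<Longrightarrow> N T \<star> ?c ` UNIV = ?V" "\<And>T. T \<in> \<Theta> \<Longrightarrow> T \<noteq> Tinf \<Longrightarrow> class T (N T) = u T"
        "\<And>T. T \<in> \<Theta> \<Longrightarrow> T \<notin> ?E \<Longrightarrow> N T = loc T" "\<And>T. T \<in> \<Theta> \<Longrightarrow> T \<notin> ?E \<Longrightarrow> N' T = loc T"
      using NN' by blast+
    have N'_UNIV: "N' T \<star> ?c ` UNIV = IntD \<star> ?c ` UNIV" if T: "T \<in> \<Theta>" for T
      using const.unitary_inverse[OF N(1)[OF T]] N(2)[OF T] loc_UNIV[OF T] IntD_UNIV by simp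
    obtain I I' where I: "inverse_pair IntD I I'" "\<And>T. T \<in> \<Theta> \<Longrightarrow> I \<star> ?c ` T = N T"
      by (rule Int.glue_inverse_pair[OF fin _ Int.image_base_R Int.image_base_R N(1) _ N'_UNIV])
         (use N IntD_UNIV in auto)
    have "I \<in> P"
      using I Tinf_mem N(4)[OF Tinf_mem] by (auto simp: P_def)
    moreover have "\<psi> I = u"
    proof
      fix T show "\<psi> I T = u T"
        using u I(2)[of T] N(3)[of T] unfolding carrier_G
        by (cases "T \<in> \<Theta> - {Tinf}") (auto simp: \<psi>_def PiE_def extensional_def)
    qed
    ultimately show ?thesis by blast
  qed
  have \<psi>: "\<psi> ` P = carrier ?G"
    using \<psi>_carrier \<psi>_surj by blast
  have \<psi>_mult: "\<psi> (I \<star> J) = \<psi> I \<otimes>\<^bsub>?G\<^esub> \<psi> J" if "I \<in> P" "J \<in> P" for I J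
  proof -
    have "class T ((I \<star> J) \<star> ?c ` T) = class T (I \<star> ?c ` T) \<otimes>\<^bsub>PicInt T\<^esub> class T (J \<star> ?c ` T)"
      if T: "T \<in> \<Theta>" "T \<noteq> Tinf" for T
      unfolding PicInt_mem[OF T] Int.localization_mult[OF T(1)]
      by (rule pic_extension.quot_class_mult[OF mem[OF T(1)] P_loc[OF \<open>I \<in> P\<close> T(1)] P_loc[OF \<open>J \<in> P\<close> T(1)]])
    then show ?thesis
      by (simp add: \<psi>_def cong: restrict_cong)
  qed
  have inv_P: "inv_frac_ideal IntD I" if "I \<in> P" for I
    using that by (auto simp: P_def inv_iff(1))
  have \<phi>: "classD I \<in> carrier (PicInt D)" if "inv_frac_ideal IntD I" for I
    using pic_extension.quot_class_carrier[OF base] that by (auto simp: PicInt_D)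
  \<comment> \<open>At each member, \<open>J\<close> is \<open>I\<close> twisted by an invertible
    ideal of T, which can be taken to be T itself where both ideals are trivial. These ideals glue
    to an invertible ideal \<open>B\<close> of \<open>D\<close>, and J = I B is then a local
    statement.\<close>
  have fibre1: "classD I = classD J" if I: "I \<in> P" and J: "J \<in> P" and eq: "\<psi> I = \<psi> J" for I J
  proof -
    obtain I' where I': "inverse_pair IntD I I'" "I \<star> ?c ` Tinf = loc Tinf"
      using I by (auto simp: P_def)
    obtain J' where J': "inverse_pair IntD J J'" "J \<star> ?c ` Tinf = loc Tinf"
      using J by (auto simp: P_def)
    let ?E = "{T\<in>\<Theta>. I \<star> ?c ` T \<noteq> loc T} \<union> {T\<in>\<Theta>. J \<star> ?c ` T \<noteq> loc T}"
    have fin: "finite ?E"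
      using Int.finite_nontrivial[OF I'] Int.finite_nontrivial[OF J'] by simp
    have E: "?E \<subseteq> \<Theta> - {Tinf}"
      using I'(2) J'(2) by auto
    have ex: "\<exists>B B'. inverse_pair T B B' \<and> J \<star> ?c ` T = (I \<star> ?c ` T) \<star> ?c ` B \<and> (T \<notin> ?E \<longrightarrow> B = T \<and> B' = T)"
      if T: "T \<in> \<Theta>" for T
    proof (cases "T \<in> ?E")
      case True
      then have "T \<noteq> Tinf" using E by blast
      then have "class T (I \<star> ?c ` T) = class T (J \<star> ?c ` T)"
        using fun_cong[OF eq, of T] T by (simp add: \<psi>_def)
      moreover have "(I \<star> ?c ` T) \<star> ?c ` UNIV = ?V" "(J \<star> ?c ` T) \<star> ?c ` UNIV = ?V"
        using P_UNIV I J by (simp_all add: Int.localization_UNIV[OF T])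
      ultimately show ?thesis
        using class_eqD[OF T Int.localization_inverse_pair[OF T I'(1)] _ Int.localization_inverse_pair[OF T J'(1)]]
          True by metis
    next
      case False
      then have "J \<star> ?c ` T = (I \<star> ?c ` T) \<star> ?c ` T"
        using T by (simp add: Int.localization_localization)
      moreover have "inverse_pair T T T"
        by (simp add: inverse_pair_def set_prod_subring[OF subring_mem[OF T]])
      ultimately show ?thesis by blast
    qed
    obtain N N' where NN': "\<forall>T\<in>\<Theta>. inverse_pair T (N T) (N' T) \<and>
        J \<star> ?c ` T = (I \<star> ?c ` T) \<star> ?c ` N T \<and> (T \<notin> ?E \<longrightarrow> N T = T \<and> N' T = T)"
      by atomize_elim (rule pair_choice, rule ex)
    have N: "\<And>T. T \<in> \<Theta> \<Longrightarrow> inverse_pair T (N T) (N' T)"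
        "\<And>T. T \<in> \<Theta> \<Longrightarrow> J \<star> ?c ` T = (I \<star> ?c ` T) \<star> ?c ` N T"
        "\<And>T. T \<in> \<Theta> \<Longrightarrow> T \<notin> ?E \<Longrightarrow> N T = T" "\<And>T. T \<in> \<Theta> \<Longrightarrow> T \<notin> ?E \<Longrightarrow> N' T = T"
      using NN' by blast+
    have D_UNIV: "D \<star> UNIV = UNIV"
      using inverse_pair_UNIV[OF subring_base, of D D] by (simp add: inverse_pair_def set_prod_subring[OF subring_base])
    have "\<exists>B B'. inverse_pair D B B' \<and> (\<forall>T\<in>\<Theta>. B \<star> T = N T)"
    proof (rule embedded_ring.glue_inverse_pair[OF embedded_ring_base fin E, of D D N N'])
      show "inverse_pair (D \<star> (\<lambda>x. x) ` T) (N T) (N' T)" if "T \<in> \<Theta>" for T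
        using N(1)[OF that] base_module[OF that] by simp
      show "N T \<star> range (\<lambda>x. x) = D \<star> range (\<lambda>x. x)" "N' T \<star> range (\<lambda>x. x) = D \<star> range (\<lambda>x. x)"
        if T: "T \<in> \<Theta>" for T
        using inverse_pair_UNIV[OF subring_mem[OF T] N(1)[OF T]]
          inverse_pair_UNIV[OF subring_mem[OF T] inverse_pair_sym[OF N(1)[OF T]]] D_UNIV by simp_all
      show "N T = D \<star> (\<lambda>x. x) ` T" "N' T = D \<star> (\<lambda>x. x) ` T" if T: "T \<in> \<Theta> - ?E" for T
        using N(3,4)[of T] T base_module[of T] by auto
    qed (auto simp: set_prod_subring[OF subring_base])
    then obtain B B' where B: "inverse_pair D B B'" "\<And>T. T \<in> \<Theta> \<Longrightarrow> B \<star> T = N T"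
      by blast
    have "J = I \<star> ?c ` B"
    proof (rule Int.local_eq)
      show "?c ` D \<star> J = J"
        using J'(1) by (intro Int.base_module_of_R_module) (simp add: inverse_pair_def)
      show "?c ` D \<star> (I \<star> ?c ` B) = I \<star> ?c ` B"
        using twist_inverse_pair[OF I'(1) B(1)]
        by (intro Int.base_module_of_R_module) (simp add: inverse_pair_def)
      show "J \<star> ?c ` T = (I \<star> ?c ` B) \<star> ?c ` T" if T: "T \<in> \<Theta>" for T
        unfolding localization_twist[OF T] B(2)[OF T] by (rule N(2)[OF T])
    qed
    then show ?thesis
      using classD_twist[OF I'(1) B(1)] by simp
  qed
  \<comment> \<open>This converse comparison of fibres is what makes the first arrow
    injective.\<close>
  have fibre2: "\<psi> I = \<psi> J" if I: "I \<in> P" and J: "J \<in> P" and eq: "classD I = classD J" for I J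
    unfolding \<psi>_def by (intro restrict_ext class_localization_eq inv_P I J eq) blast
  obtain f where f: "f \<in> hom ?G (PicInt D)" "\<And>I. I \<in> P \<Longrightarrow> f (\<psi> I) = classD I"
  proof (rule induced_hom[of \<psi> P ?G classD "PicInt D" "(\<star>)"])
    show "classD ` P \<subseteq> carrier (PicInt D)"
      using \<phi> inv_P by blast
    show "classD (I \<star> J) = classD I \<otimes>\<^bsub>PicInt D\<^esub> classD J" if "I \<in> P" "J \<in> P" for I J
      unfolding PicInt_D by (rule pic_extension.quot_class_mult[OF base inv_P inv_P]) (use that in auto)
    show "\<psi> ` P = carrier ?G"
      by (rule \<psi>)
    show "I \<star> J \<in> P" if "I \<in> P" "J \<in> P" for I J
      using that by (rule P_mult)
    show "\<psi> (I \<star> J) = \<psi> I \<otimes>\<^bsub>?G\<^esub> \<psi> J" if "I \<in> P" "J \<in> P" for I J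
      using that by (rule \<psi>_mult)
    show "classD I = classD J" if "I \<in> P" "J \<in> P" "\<psi> I = \<psi> J" for I J
      using that by (rule fibre1)
  qed (rule that)
  have f_inj: "inj_on f (carrier ?G)"
  proof (rule inj_onI)
    fix u v assume u: "u \<in> carrier ?G" and v: "v \<in> carrier ?G" and eq: "f u = f v"
    obtain I where I: "I \<in> P" "u = \<psi> I"
      using u unfolding \<psi>[symmetric] by blast
    obtain J where J: "J \<in> P" "v = \<psi> J"
      using v unfolding \<psi>[symmetric] by blast
    have "classD I = classD J"
      using eq unfolding I(2) J(2) f(2)[OF I(1)] f(2)[OF J(1)] .
    then show "u = v"
      unfolding I(2) J(2) by (rule fibre2[OF I(1) J(1)])
  qed
  have class_inf: "inv_frac_ideal (loc Tinf) (I \<star> ?c ` Tinf)" if "inv_frac_ideal IntD I" for I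
    using that Int.localization_inverse_pair[OF Tinf_mem] by (auto simp: inv_iff(1) inv_iff(2)[OF Tinf_mem])
  obtain g where g: "g \<in> hom (PicInt D) (PicInt2 D Tinf)"
    "\<And>I. I \<in> Collect (inv_frac_ideal IntD) \<Longrightarrow> g (classD I) = class Tinf (I \<star> ?c ` Tinf)"
  proof (rule induced_hom[of classD "Collect (inv_frac_ideal IntD)" "PicInt D"
        "\<lambda>I. class Tinf (I \<star> ?c ` Tinf)" "PicInt2 D Tinf" "(\<star>)"])
    show "classD ` Collect (inv_frac_ideal IntD) = carrier (PicInt D)"
      using pic_extension.quot_class_carrier[OF base] by (simp add: PicInt_D)
    show "(\<lambda>I. class Tinf (I \<star> ?c ` Tinf)) ` Collect (inv_frac_ideal IntD) \<subseteq> carrier (PicInt2 D Tinf)"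
      using pic_extension.quot_class_carrier[OF mem[OF Tinf_mem]] class_inf by (auto simp: PicInt2_Tinf)
    show "I \<star> J \<in> Collect (inv_frac_ideal IntD)"
      if "I \<in> Collect (inv_frac_ideal IntD)" "J \<in> Collect (inv_frac_ideal IntD)" for I J
      using that inverse_pair_mult[OF Int.subring_R] unfolding mem_Collect_eq inv_iff(1) by blast
    show "classD (I \<star> J) = classD I \<otimes>\<^bsub>PicInt D\<^esub> classD J"
      if "I \<in> Collect (inv_frac_ideal IntD)" "J \<in> Collect (inv_frac_ideal IntD)" for I J
      unfolding PicInt_D using that by (simp add: pic_extension.quot_class_mult[OF base])
    show "class Tinf ((I \<star> J) \<star> ?c ` Tinf) =
        class Tinf (I \<star> ?c ` Tinf) \<otimes>\<^bsub>PicInt2 D Tinf\<^esub> class Tinf (J \<star> ?c ` Tinf)"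
      if "I \<in> Collect (inv_frac_ideal IntD)" "J \<in> Collect (inv_frac_ideal IntD)" for I J
      using that class_inf unfolding PicInt2_Tinf Int.localization_mult[OF Tinf_mem]
      by (simp add: pic_extension.quot_class_mult[OF mem[OF Tinf_mem]])
    show "class Tinf (I \<star> ?c ` Tinf) = class Tinf (J \<star> ?c ` Tinf)"
      if IJ: "I \<in> Collect (inv_frac_ideal IntD)" "J \<in> Collect (inv_frac_ideal IntD)" "classD I = classD J"
      for I J
      using class_localization_eq[OF Tinf_mem _ _ IJ(3)] IJ(1,2) by simp
  qed (rule that)
  have g_surj: "g ` carrier (PicInt D) = carrier (PicInt2 D Tinf)"
  proof
    show "g ` carrier (PicInt D) \<subseteq> carrier (PicInt2 D Tinf)"
      using g(1) by (auto simp: hom_def)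
    show "carrier (PicInt2 D Tinf) \<subseteq> g ` carrier (PicInt D)"
    proof
      fix u assume "u \<in> carrier (PicInt2 D Tinf)"
      then obtain J J' where J: "inverse_pair (loc Tinf) J J'" "J \<star> ?c ` UNIV = ?V" "class Tinf J = u"
        using class_surj[OF Tinf_mem] unfolding PicInt2_Tinf by metis
      \<comment> \<open>The representative was chosen unitary; lifting also asks this of its
        inverse.\<close>
      have "J' \<star> ?c ` UNIV = ?V"
        using const.unitary_inverse[OF J(1)] J(2) loc_UNIV[OF Tinf_mem] by simp
      then obtain I I' where I: "inverse_pair IntD I I'" "I \<star> ?c ` Tinf = J"
        using Int.lift_inverse_pair[OF J(1)] J(2) IntD_UNIV by metis
      then have inv: "inv_frac_ideal IntD I"
        by (auto simp: inv_iff(1))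
      then have "g (classD I) = u"
        using g(2)[of I] I(2) J(3) by simp
      then show "u \<in> g ` carrier (PicInt D)"
        using \<phi>[OF inv] by blast
    qed
  qed
  have one_inf: "class Tinf (loc Tinf) = \<one>\<^bsub>PicInt2 D Tinf\<^esub>"
    unfolding PicInt2_Tinf by (rule pic_extension.quot_class_one[OF mem[OF Tinf_mem]])
  have f_image: "f ` carrier ?G = classD ` P"
    unfolding \<psi>[symmetric] image_image using f(2) by (rule image_cong[OF refl])
  have "f ` carrier ?G = kernel (PicInt D) (PicInt2 D Tinf) g"
    unfolding f_image
  proof
    show "classD ` P \<subseteq> kernel (PicInt D) (PicInt2 D Tinf) g"
    proof
      fix y assume "y \<in> classD ` P"
      then obtain I where I: "I \<in> P" "y = classD I"
        by blast
      then have "g y = \<one>\<^bsub>PicInt2 D Tinf\<^esub>"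
        using g(2)[of I] inv_P[OF I(1)] one_inf by (simp add: P_def)
      then show "y \<in> kernel (PicInt D) (PicInt2 D Tinf) g"
        using \<phi>[OF inv_P[OF I(1)]] I(2) by (simp add: kernel_def)
    qed
    show "kernel (PicInt D) (PicInt2 D Tinf) g \<subseteq> classD ` P"
    proof
      fix y assume y: "y \<in> kernel (PicInt D) (PicInt2 D Tinf) g"
      then have "y \<in> classD ` carrier (Inv_group IntD)"
        using pic_extension.quot_class_carrier[OF base] by (simp add: kernel_def PicInt_D)
      then obtain I0 where I0: "inv_frac_ideal IntD I0" "y = classD I0"
        by auto
      obtain I0' where I0': "inverse_pair IntD I0 I0'"
        using I0(1) inv_iff(1) by blast
      \<comment> \<open>Rescaling to a unitary ideal keeps the class in Pic_Int(D) and turns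
        triviality of the class at \<open>Tinf\<close> into an equality of ideals.\<close>
      obtain h where h: "h \<noteq> 0" "((\<lambda>r. h * r) ` I0) \<star> ?c ` UNIV = ?V"
        using unitary_representative[OF qf_IntD IntD_UNIV I0'] by blast
      define I where "I = (\<lambda>r. h * r) ` I0"
      obtain I' where I': "inverse_pair IntD I I'"
        using inverse_pair_scale[OF I0' h(1)] unfolding I_def by blast
      have invI: "inv_frac_ideal IntD I"
        using I' inv_iff(1) by blast
      have "I0 \<star> ?c ` D = I0"
        using Int.base_module_of_R_module[of I0] I0' by (simp add: inverse_pair_def set_prod_commute)
      moreover have "inv_frac_ideal D D"
        using inv_frac_ideal_iff[OF qf] set_prod_subring[OF subring_base] by (auto simp: inverse_pair_def)
      ultimately have "classD I0 = classD I"
        unfolding pic_extension.quot_class_eq_iff[OF base I0(1) invI]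
        using h(1) by (intro exI[of _ h] exI[of _ D]) (simp add: I_def)
      then have yI: "y = classD I"
        using I0(2) by simp
      then have "class Tinf (I \<star> ?c ` Tinf) = class Tinf (loc Tinf)"
        using y g(2)[of I] invI one_inf by (simp add: kernel_def)
      moreover have "inverse_pair (loc Tinf) (loc Tinf) (loc Tinf)"
        by (simp add: inverse_pair_def Int.localization_idem[OF Tinf_mem])
      moreover have "(I \<star> ?c ` Tinf) \<star> ?c ` UNIV = ?V"
        using h(2) by (simp add: I_def Int.localization_UNIV[OF Tinf_mem])
      \<comment> \<open>Triviality of the class means that \<open>I\<close> becomes trivial at
        \<open>Tinf\<close> after a twist by an invertible ideal \<open>B\<close> of
        \<open>Tinf\<close>. Lifting \<open>B\<close> to an ideal \<open>C\<close> of
        \<open>D\<close> makes I C an element of \<open>P\<close> with the same class as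
        \<open>I\<close>.\<close>
      ultimately obtain B B' where B: "inverse_pair Tinf B B'" "loc Tinf = (I \<star> ?c ` Tinf) \<star> ?c ` B"
        using class_eqD[OF Tinf_mem Int.localization_inverse_pair[OF Tinf_mem I']] loc_UNIV[OF Tinf_mem] by metis
      have D_UNIV: "D \<star> UNIV = UNIV"
        using inverse_pair_UNIV[OF subring_base, of D D] by (simp add: inverse_pair_def set_prod_subring[OF subring_base])
      have "\<exists>C C'. inverse_pair D C C' \<and> C \<star> Tinf = B"
      proof (rule embedded_ring.lift_inverse_pair[OF embedded_ring_base, of B B'])
        show "inverse_pair (D \<star> (\<lambda>x. x) ` Tinf) B B'"
          using B(1) base_module[OF Tinf_mem] by simp
        show "B \<star> range (\<lambda>x. x) = D \<star> range (\<lambda>x. x)" "B' \<star> range (\<lambda>x. x) = D \<star> range (\<lambda>x. x)"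
          using inverse_pair_UNIV[OF subring_mem[OF Tinf_mem] B(1)] D_UNIV
            inverse_pair_UNIV[OF subring_mem[OF Tinf_mem] inverse_pair_sym[OF B(1)]] by simp_all
      qed auto
      then obtain C C' where C: "inverse_pair D C C'" "C \<star> Tinf = B" by blast
      have "I \<star> ?c ` C \<in> P"
        unfolding P_def using twist_inverse_pair[OF I' C(1)] localization_twist[OF Tinf_mem, of I C] B(2) C(2)
        by auto
      then show "y \<in> classD ` P"
        unfolding yI classD_twist[OF I' C(1), symmetric] by (rule imageI)
    qed
  qed
  then show ?thesis
    using f(1) f_inj g(1) g_surj by blast
qed

end

theorem theorem6p4:
  fixes D :: "'k::field set" and \<Theta> :: "'k set set" and Tinf :: "'k set"
  assumes "domain_with_qf D"
    and "weak_jaffard_pointed D \<Theta> Tinf"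
  shows "\<exists>f g. f \<in> hom (sum_group (\<Theta> - {Tinf}) PicInt) (PicInt D) \<and>
               inj_on f (carrier (sum_group (\<Theta> - {Tinf}) PicInt)) \<and>
               g \<in> hom (PicInt D) (PicInt2 D Tinf) \<and>
               g ` carrier (PicInt D) = carrier (PicInt2 D Tinf) \<and>
               f ` carrier (sum_group (\<Theta> - {Tinf}) PicInt) = kernel (PicInt D) (PicInt2 D Tinf) g"
proof (rule pointed_family.exact_sequence)
  have pj: "pre_jaffard D \<Theta>" and N1: "N1 D \<Theta> = {Tinf}"
    using assms(2) by (simp_all add: weak_jaffard_pointed_def)
  show "pointed_family D \<Theta> Tinf"
  proof
    show "Tinf \<in> \<Theta>"
      using N1 unfolding N1_def by blast
    show "jaffard_overring D T" if "T \<in> \<Theta>" "T \<noteq> Tinf" for T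
      using N1 that unfolding N1_def by blast
  qed (rule assms(1) pj)+
qed

end
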